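(* Let $\mathcal{U},\mathcal{Y}$ be Hilbert spaces, $\mathcal{F}$ a closed subspace of $\mathcal{U}$, $\mathcal{G}=\mathcal{U}\ominus\mathcal{F}$, and $\omega=\begin{pmatrix}\omega_1\\ \omega_2\end{pmatrix}:\mathcal{F}\to\mathcal{Y}\oplus\mathcal{U}$ a contraction. For $\lambda\in\mathbb{D}$ define $\Phi_{1,1}(\lambda)=\lambda\Pi_{\mathcal{G}}(I_{\mathcal{U}}-\lambda\omega_2\Pi_{\mathcal{F}})^{-1}\Pi_{\mathcal{U}}D_{\omega^*}$, $\Phi_{1,2}(\lambda)=\Pi_{\mathcal{G}}(I_{\mathcal{U}}-\lambda\omega_2\Pi_{\mathcal{F}})^{-1}$, $\Phi_{2,1}(\lambda)=\Pi_{\mathcal{Y}}D_{\omega^*}+\lambda\omega_1\Pi_{\mathcal{F}}(I_{\mathcal{U}}-\lambda\omega_2\Pi_{\mathcal{F}})^{-1}\Pi_{\mathcal{U}}D_{\omega^*}$, $\Phi_{2,2}(\lambda)=\omega_1\Pi_{\mathcal{F}}(I_{\mathcal{U}}-\lambda\omega_2\Pi_{\mathcal{F}})^{-1}$. Then the operator $$\begin{pmatrix}M_{\Phi_{1,1}}&\Gamma_{\Phi_{1,2}}\\ M_{\Phi_{2,1}}&\Gamma_{\Phi_{2,2}}\end{pmatrix}:H^2(\mathcal{D}_{\omega^*})\oplus\mathcal{U}\to H^2(\mathcal{G})\oplus H^2(\mathcal{Y})$$ is a co-isometry. Moreover, this operator is unitary whenever $\omega$ is an isometry and $\omega_2\Pi_{\mathcal{F}}$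 is pointwise stable, i.e. $(\omega_2\Pi_{\mathcal{F}})^nu\to0$ as $n\to\infty$ for every $u\in\mathcal{U}$.
   Context: $\mathbb{D}$ is the open unit disc. $\Pi_{\mathcal{F}}:\mathcal{U}\to\mathcal{F}$, $\Pi_{\mathcal{G}}:\mathcal{U}\to\mathcal{G}$ are orthogonal projections; $D_{\omega^*}=(I-\omega\omega^* )^{1/2}$ on $\mathcal{Y}\oplus\mathcal{U}$, $\mathcal{D}_{\omega^*}$ is the closure of its range, and $\Pi_{\mathcal{Y}},\Pi_{\mathcal{U}}$ are the coordinate projections of $\mathcal{Y}\oplus\mathcal{U}$. It is known that $\Phi_{1,1},\Phi_{2,1}$ are Schur class functions (contraction-valued analytic functions on $\mathbb{D}$), with values from $\mathcal{D}_{\omega^*}$ into $\mathcal{G}$, resp. $\mathcal{Y}$; $M_{\Phi_{i,1}}$ denotes the associated contractive multiplication operator between vector-valued Hardy spaces. For an operator-valued function $H$ on $\mathbb{D}$ with values $\mathcal{U}\to\mathcal{Z}$, $\Gamma_H:\mathcal{U}\to H^2(\mathcal{Z})$ is defined by $(\Gamma_Hu)(\lambda)=H(\lambda)u$; for $H=\Phi_{1,2},\Phi_{2,2}$ this is a known bounded contraction. *)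

theory Defs
  imports "HOL-Analysis.Analysis"
begin

class complex_vector = real_vector +
  fixes scaleC :: "complex \<Rightarrow> 'a \<Rightarrow> 'a" (infixr \<open>*\<^sub>C\<close> 75)
  assumes scaleC_add_right: "a *\<^sub>C (x + y) = a *\<^sub>C x + a *\<^sub>C y"
    and scaleC_add_left: "(a + b) *\<^sub>C x = a *\<^sub>C x + b *\<^sub>C x"
    and scaleC_scaleC: "a *\<^sub>C (b *\<^sub>C x) = (a * b) *\<^sub>C x"
    and scaleC_one: "1 *\<^sub>C x = x"
    and scaleR_scaleC: "r *\<^sub>R x = complex_of_real r *\<^sub>C x"

class complex_inner = complex_vector + real_normed_vector +
  fixes cinner :: "'a \<Rightarrow> 'a \<Rightarrow> complex"
  assumes cinner_commute: "cinner x y = cnj (cinner y x)"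
    and cinner_add_left: "cinner (x + y) z = cinner x z + cinner y z"
    and cinner_scaleC_left: "cinner (c *\<^sub>C x) y = cnj c * cinner x y"
    and cinner_nonneg: "Im (cinner x x) = 0 \<and> 0 \<le> Re (cinner x x)"
    and cinner_eq_zero_iff: "cinner x x = 0 \<longleftrightarrow> x = 0"
    and norm_eq_sqrt_cinner: "norm x = sqrt (Re (cinner x x))"

class chilbert_space = complex_inner + complete_space

instantiation prod :: (complex_vector, complex_vector) complex_vector
begin
definition scaleC_prod_def: "c *\<^sub>C x = (c *\<^sub>C fst x, c *\<^sub>C snd x)"
instance
  by standard (auto simp: scaleC_prod_def scaleR_prod_def scaleC_add_right scaleC_add_left
      scaleC_scaleC scaleC_one scaleR_scaleC)
end

instantiation prod :: (complex_inner, complex_inner) complex_inner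
begin
definition cinner_prod_def: "cinner x y = cinner (fst x) (fst y) + cinner (snd x) (snd y)"
instance
proof
  fix x y z :: "'a \<times> 'b" and c :: complex
  show "cinner x y = cnj (cinner y x)"
    unfolding cinner_prod_def by (metis complex_cnj_add cinner_commute)
  show "cinner (x + y) z = cinner x z + cinner y z"
    unfolding cinner_prod_def by (simp add: cinner_add_left)
  show "cinner (c *\<^sub>C x) y = cnj c * cinner x y"
    unfolding cinner_prod_def scaleC_prod_def by (simp add: cinner_scaleC_left distrib_left)
  show "Im (cinner x x) = 0 \<and> 0 \<le> Re (cinner x x)"
    unfolding cinner_prod_def using cinner_nonneg[of "fst x"] cinner_nonneg[of "snd x"] by simp
  have a: "Im (cinner (fst x) (fst x)) = 0" "0 \<le> Re (cinner (fst x) (fst x))"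
       "Im (cinner (snd x) (snd x)) = 0" "0 \<le> Re (cinner (snd x) (snd x))"
    using cinner_nonneg by auto
  show "cinner x x = 0 \<longleftrightarrow> x = 0"
  proof
    assume h: "cinner x x = 0"
    have "Re (cinner (fst x) (fst x)) = 0" "Re (cinner (snd x) (snd x)) = 0"
      using h a unfolding cinner_prod_def by (auto simp: complex_eq_iff)
    then have "cinner (fst x) (fst x) = 0" "cinner (snd x) (snd x) = 0"
      using a by (auto simp: complex_eq_iff)
    then show "x = 0" by (simp add: cinner_eq_zero_iff prod_eq_iff)
  next
    assume "x = 0"
    then show "cinner x x = 0" unfolding cinner_prod_def
      using cinner_eq_zero_iff[of "0::'a"] cinner_eq_zero_iff[of "0::'b"] by simp
  qed
  have "norm (fst x) ^ 2 = Re (cinner (fst x) (fst x))" "norm (snd x) ^ 2 = Re (cinner (snd x) (snd x))"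
    using a by (simp_all add: norm_eq_sqrt_cinner)
  then show "norm x = sqrt (Re (cinner x x))"
    unfolding cinner_prod_def norm_prod_def by simp
qed
end

instance prod :: (chilbert_space, chilbert_space) chilbert_space ..

definition clinear :: "('a::complex_vector \<Rightarrow> 'b::complex_vector) \<Rightarrow> bool" where
  "clinear T \<longleftrightarrow> (\<forall>x y. T (x + y) = T x + T y) \<and> (\<forall>c x. T (c *\<^sub>C x) = c *\<^sub>C T x)"

definition cbounded_linear :: "('a::complex_inner \<Rightarrow> 'b::complex_inner) \<Rightarrow> bool" where
  "cbounded_linear T \<longleftrightarrow> clinear T \<and> (\<exists>K. \<forall>x. norm (T x) \<le> K * norm x)"

definition positive_op :: "('a::complex_inner \<Rightarrow> 'a) \<Rightarrow> bool" where
  "positive_op T \<longleftrightarrow> (\<forall>x. Im (cinner x (T x)) = 0 \<and> 0 \<le> Re (cinner x (T x)))"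

definition op_sqrt :: "('a::chilbert_space \<Rightarrow> 'a) \<Rightarrow> ('a \<Rightarrow> 'a)" where
  "op_sqrt P = (THE S. cbounded_linear S \<and> positive_op S \<and> (\<forall>x. S (S x) = P x))"

definition closed_csubspace :: "'a::chilbert_space set \<Rightarrow> bool" where
  "closed_csubspace F \<longleftrightarrow> 0 \<in> F \<and> (\<forall>x\<in>F. \<forall>y\<in>F. x + y \<in> F)
      \<and> (\<forall>c. \<forall>x\<in>F. c *\<^sub>C x \<in> F) \<and> closed F"

definition orth_compl :: "'a::chilbert_space set \<Rightarrow> 'a set" where
  "orth_compl F = {x. \<forall>f\<in>F. cinner f x = 0}"

definition proj :: "'a::chilbert_space set \<Rightarrow> 'a \<Rightarrow> 'a" where
  "proj F x = (THE p. p \<in> F \<and> (\<forall>f\<in>F. cinner f (x - p) = 0))"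

definition op_inv :: "('a \<Rightarrow> 'b) \<Rightarrow> 'b \<Rightarrow> 'a" where
  "op_inv T y = (THE x. T x = y)"

section \<open>Vector-valued Hardy space, via Taylor coefficients\<close>

definition H2 :: "'a::chilbert_space set \<Rightarrow> (nat \<Rightarrow> 'a) set" where
  "H2 Z = {a. (\<forall>n. a n \<in> Z) \<and> summable (\<lambda>n. (norm (a n))\<^sup>2)}"

definition h2_eval :: "(nat \<Rightarrow> 'a::chilbert_space) \<Rightarrow> complex \<Rightarrow> 'a" where
  "h2_eval a z = (\<Sum>n. (z ^ n) *\<^sub>C a n)"

definition h2_inner :: "(nat \<Rightarrow> 'a::chilbert_space) \<Rightarrow> (nat \<Rightarrow> 'a) \<Rightarrow> complex" where
  "h2_inner a b = (\<Sum>n. cinner (a n) (b n))"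

definition mult_op :: "(complex \<Rightarrow> 'a::chilbert_space \<Rightarrow> 'b::chilbert_space) \<Rightarrow> (nat \<Rightarrow> 'a) \<Rightarrow> (nat \<Rightarrow> 'b)" where
  "mult_op \<Phi> f = (THE g. g \<in> H2 UNIV \<and> (\<forall>z\<in>ball 0 1. h2_eval g z = \<Phi> z (h2_eval f z)))"

definition gamma_op :: "(complex \<Rightarrow> 'a::chilbert_space \<Rightarrow> 'b::chilbert_space) \<Rightarrow> 'a \<Rightarrow> (nat \<Rightarrow> 'b)" where
  "gamma_op H u = (THE g. g \<in> H2 UNIV \<and> (\<forall>z\<in>ball 0 1. h2_eval g z = H z u))"

definition is_adjoint_on where
  "is_adjoint_on X ipX Y ipY T S \<longleftrightarrow> (\<forall>x\<in>X. T x \<in> Y) \<and> (\<forall>y\<in>Y. S y \<in> X)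
     \<and> (\<forall>x\<in>X. \<forall>y\<in>Y. ipY (T x) y = ipX x (S y))"

definition coisometry_on where
  "coisometry_on X ipX Y ipY T \<longleftrightarrow>
     (\<exists>S. is_adjoint_on X ipX Y ipY T S \<and> (\<forall>y\<in>Y. T (S y) = y))"

definition unitary_on where
  "unitary_on X ipX Y ipY T \<longleftrightarrow>
     (\<exists>S. is_adjoint_on X ipX Y ipY T S \<and> (\<forall>y\<in>Y. T (S y) = y) \<and> (\<forall>x\<in>X. S (T x) = x))"

text \<open>\<open>\<omega> = (\<omega>\<^sub>1, \<omega>\<^sub>2) : F \<rightarrow> Y \<oplus> U\<close> is given by two maps whose values are only relevant on F.\<close>
definition omega_contraction :: "'u::chilbert_space set \<Rightarrow> ('u \<Rightarrow> 'y::chilbert_space) \<Rightarrow> ('u \<Rightarrow> 'u) \<Rightarrow> bool" where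
  "omega_contraction F \<omega>1 \<omega>2 \<longleftrightarrow>
     (\<forall>f\<in>F. \<forall>g\<in>F. \<omega>1 (f + g) = \<omega>1 f + \<omega>1 g \<and> \<omega>2 (f + g) = \<omega>2 f + \<omega>2 g)
     \<and> (\<forall>c. \<forall>f\<in>F. \<omega>1 (c *\<^sub>C f) = c *\<^sub>C \<omega>1 f \<and> \<omega>2 (c *\<^sub>C f) = c *\<^sub>C \<omega>2 f)
     \<and> (\<forall>f\<in>F. (norm (\<omega>1 f))\<^sup>2 + (norm (\<omega>2 f))\<^sup>2 \<le> (norm f)\<^sup>2)"

definition omega_isometry :: "'u::chilbert_space set \<Rightarrow> ('u \<Rightarrow> 'y::chilbert_space) \<Rightarrow> ('u \<Rightarrow> 'u) \<Rightarrow> bool" where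
  "omega_isometry F \<omega>1 \<omega>2 \<longleftrightarrow> (\<forall>f\<in>F. (norm (\<omega>1 f))\<^sup>2 + (norm (\<omega>2 f))\<^sup>2 = (norm f)\<^sup>2)"

definition omega_adj :: "'u::chilbert_space set \<Rightarrow> ('u \<Rightarrow> 'y::chilbert_space) \<Rightarrow> ('u \<Rightarrow> 'u) \<Rightarrow> 'y \<times> 'u \<Rightarrow> 'u" where
  "omega_adj F \<omega>1 \<omega>2 p = (THE f. f \<in> F \<and> (\<forall>g\<in>F. cinner (\<omega>1 g, \<omega>2 g) p = cinner g f))"

definition defect_adj :: "'u::chilbert_space set \<Rightarrow> ('u \<Rightarrow> 'y::chilbert_space) \<Rightarrow> ('u \<Rightarrow> 'u) \<Rightarrow> 'y \<times> 'u \<Rightarrow> 'y \<times> 'u" where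
  "defect_adj F \<omega>1 \<omega>2 = op_sqrt (\<lambda>p. p - (\<omega>1 (omega_adj F \<omega>1 \<omega>2 p), \<omega>2 (omega_adj F \<omega>1 \<omega>2 p)))"

definition resolv :: "'u::chilbert_space set \<Rightarrow> ('u \<Rightarrow> 'u) \<Rightarrow> complex \<Rightarrow> 'u \<Rightarrow> 'u" where
  "resolv F \<omega>2 z = op_inv (\<lambda>u. u - z *\<^sub>C \<omega>2 (proj F u))"

definition Phi11 where
  "Phi11 F \<omega>1 \<omega>2 z p = z *\<^sub>C proj (orth_compl F) (resolv F \<omega>2 z (snd (defect_adj F \<omega>1 \<omega>2 p)))"

definition Phi12 where
  "Phi12 F (\<omega>1 :: 'u \<Rightarrow> 'y) \<omega>2 z u = proj (orth_compl F) (resolv F \<omega>2 z u)"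

definition Phi21 where
  "Phi21 F \<omega>1 \<omega>2 z p = fst (defect_adj F \<omega>1 \<omega>2 p)
     + z *\<^sub>C \<omega>1 (proj F (resolv F \<omega>2 z (snd (defect_adj F \<omega>1 \<omega>2 p))))"

definition Phi22 where
  "Phi22 F \<omega>1 \<omega>2 z u = \<omega>1 (proj F (resolv F \<omega>2 z u))"

definition block_op where
  "block_op F \<omega>1 \<omega>2 = (\<lambda>(f, u).
     ((\<lambda>n. mult_op (Phi11 F \<omega>1 \<omega>2) f n + gamma_op (Phi12 F \<omega>1 \<omega>2) u n),
      (\<lambda>n. mult_op (Phi21 F \<omega>1 \<omega>2) f n + gamma_op (Phi22 F \<omega>1 \<omega>2) u n)))"

end

theory Submission
  imports Defs
begin

text \<open>
  Write \<open>A = \<omega>\<^sub>2 \<Pi>\<^sub>F\<close>. The block operator is the input-output map of the colligation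
  \<open>x\<^sub>0 = u\<close>, \<open>g\<^sub>n = \<Pi>\<^sub>G x\<^sub>n\<close>, \<open>(h\<^sub>n, x\<^sub>n\<^sub>+\<^sub>1) = \<omega> \<Pi>\<^sub>F x\<^sub>n + D f\<^sub>n\<close>, whose system
  operator is a co-isometry because \<open>\<omega> \<omega>\<^sup>* + D\<^sup>2 = I\<close>. Its adjoint is the backward recursion
  \<open>\<xi>\<^sub>n = g\<^sub>n + \<omega>\<^sup>* (h\<^sub>n, \<xi>\<^sub>n\<^sub>+\<^sub>1)\<close>, \<open>f\<^sub>n = D (h\<^sub>n, \<xi>\<^sub>n\<^sub>+\<^sub>1)\<close>, \<open>u = \<xi>\<^sub>0\<close> with
  \<open>\<xi>\<^sub>n \<rightarrow> 0\<close>. Feeding this input to the forward system reproduces the states \<open>\<xi>\<^sub>n\<close>, which gives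
  the co-isometry. If \<open>\<omega>\<close> is isometric, then \<open>D\<close> is the projection onto the kernel of
  \<open>\<omega>\<^sup>*\<close> and every forward trajectory satisfies the backward recursion; stability forces
  \<open>x\<^sub>n \<rightarrow> 0\<close>, and the solution of the backward recursion with this property is unique.
\<close>

section \<open>Complex inner product spaces\<close>

instance chilbert_space \<subseteq> banach ..

lemma scaleC_zero_right [simp]: "c *\<^sub>C (0::'a::complex_vector) = 0"
  using scaleC_add_right[of c 0 0] by simp

lemma scaleC_zero_left [simp]: "0 *\<^sub>C (x::'a::complex_vector) = 0"
  using scaleC_add_left[of 0 0 x] by simp

lemma scaleC_minus_one: "- x = (- 1) *\<^sub>C (x::'a::complex_vector)"
  using scaleR_scaleC[of "-1" x] by simp

lemma scaleC_diff_right: "c *\<^sub>C (x - y) = c *\<^sub>C x - c *\<^sub>C (y::'a::complex_vector)"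
  using scaleC_add_right[of c "x - y" y] by (simp add: algebra_simps)

lemma cinner_zero_left [simp]: "cinner 0 (x::'a::complex_inner) = 0"
  using cinner_add_left[of 0 0 x] by simp

lemma cinner_zero_right [simp]: "cinner (x::'a::complex_inner) 0 = 0"
  using cinner_commute[of x 0] by simp

lemma cinner_add_right: "cinner (x::'a::complex_inner) (y + z) = cinner x y + cinner x z"
  by (metis cinner_add_left cinner_commute complex_cnj_add)

lemma cinner_scaleC_right: "cinner (x::'a::complex_inner) (c *\<^sub>C y) = c * cinner x y"
  by (metis cinner_commute cinner_scaleC_left complex_cnj_cnj complex_cnj_mult)

lemma cinner_diff_left: "cinner ((x::'a::complex_inner) - y) z = cinner x z - cinner y z"
  using cinner_add_left[of "x - y" y z] by simp

lemma cinner_diff_right: "cinner (x::'a::complex_inner) (y - z) = cinner x y - cinner x z"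
  using cinner_add_right[of x "y - z" z] by simp

lemma cinner_scaleR_left: "cinner (r *\<^sub>R (x::'a::complex_inner)) y = complex_of_real r * cinner x y"
  by (simp add: scaleR_scaleC cinner_scaleC_left)

lemma cinner_scaleR_right: "cinner (x::'a::complex_inner) (r *\<^sub>R y) = complex_of_real r * cinner x y"
  by (simp add: scaleR_scaleC cinner_scaleC_right)

lemma cinner_self: "cinner x x = complex_of_real ((norm (x::'a::complex_inner))\<^sup>2)"
  using cinner_nonneg[of x] by (simp add: norm_eq_sqrt_cinner complex_eq_iff)

lemma Re_cinner_commute: "Re (cinner (y::'a::complex_inner) x) = Re (cinner x y)"
  by (metis cinner_commute complex_cnj(1) complex.sel(1) complex_surj cnj.sel(1))

lemma norm_add_sq: "(norm (x + y))\<^sup>2 = (norm x)\<^sup>2 + (norm y)\<^sup>2 + 2 * Re (cinner (x::'a::complex_inner) y)"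
proof -
  have "complex_of_real ((norm (x + y))\<^sup>2) = cinner x x + cinner y y + cinner x y + cinner y x"
    by (simp add: cinner_self[symmetric] cinner_add_left cinner_add_right del: of_real_power)
  from arg_cong[OF this, of Re] show ?thesis
    by (simp add: cinner_self Re_cinner_commute[of y x] del: of_real_power)
qed

lemma norm_scaleC: "norm (c *\<^sub>C (x::'a::complex_inner)) = cmod c * norm x"
proof -
  have "complex_of_real ((norm (c *\<^sub>C x))\<^sup>2) = complex_of_real ((cmod c * norm x)\<^sup>2)"
    by (simp only: cinner_self[symmetric] cinner_scaleC_left cinner_scaleC_right)
       (simp add: cinner_self complex_norm_square[of c, symmetric] power_mult_distrib mult_ac)
  then show ?thesis
    by (simp only: of_real_eq_iff) (simp add: power2_eq_iff_nonneg)
qed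

lemma norm_diff_sq: "(norm (x - y))\<^sup>2 = (norm x)\<^sup>2 + (norm y)\<^sup>2 - 2 * Re (cinner (x::'a::complex_inner) y)"
  using norm_add_sq[of x "- y"] cinner_diff_right[of x 0 y] by simp

lemma Re_cinner_le: "Re (cinner (x::'a::complex_inner) y) \<le> norm x * norm y"
proof (cases "x = 0 \<or> y = 0")
  case False
  then have p: "norm x > 0" "norm y > 0" by auto
  have "0 \<le> (norm (norm y *\<^sub>R x - norm x *\<^sub>R y))\<^sup>2" by simp
  also have "\<dots> = 2 * (norm x * norm y) * (norm x * norm y - Re (cinner x y))"
    unfolding norm_diff_sq
    by (simp add: cinner_scaleR_left cinner_scaleR_right power_mult_distrib algebra_simps power2_eq_square)
  finally have "0 \<le> 2 * (norm x * norm y) * (norm x * norm y - Re (cinner x y))" .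
  moreover have "0 < 2 * (norm x * norm y)" using p by simp
  ultimately have "0 \<le> norm x * norm y - Re (cinner x y)" by (metis linorder_not_le mult_pos_neg)
  then show ?thesis by simp
qed auto

text \<open>Reduces to the real version: scaling \<open>x\<close> by \<open>c = cinner x y\<close>
  rotates the inner product onto the positive real axis.\<close>

lemma cinner_cauchy_schwarz: "cmod (cinner (x::'a::complex_inner) y) \<le> norm x * norm y"
proof -
  define c where "c = cinner x y"
  show ?thesis
  proof (cases "c = 0")
    case False
    have "(cmod c)\<^sup>2 = Re (cnj c * c)"
      by (metis complex_mod_mult_cnj complex_norm_square mult.commute Re_complex_of_real)
    also have "\<dots> = Re (cinner (c *\<^sub>C x) y)" by (simp add: cinner_scaleC_left c_def)
    also have "\<dots> \<le> cmod c * (norm x * norm y)"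
      using Re_cinner_le[of "c *\<^sub>C x" y] by (simp add: norm_scaleC mult_ac)
    finally show ?thesis using False by (simp add: power2_eq_square c_def)
  qed (simp add: c_def)
qed

lemma bounded_linear_cinner_right: "bounded_linear (cinner (x::'a::complex_inner))"
  by (rule bounded_linear_intro[where K = "norm x"])
     (auto simp: cinner_add_right cinner_scaleR_right scaleR_conv_of_real mult.commute
       intro: order_trans[OF cinner_cauchy_schwarz])

text \<open>The inner product is conjugate-linear in this argument, but
  \<open>bounded_linear\<close> asks only for real linearity, so limits and series may still be
  moved through it.\<close>

lemma bounded_linear_cinner_left: "bounded_linear (\<lambda>x. cinner x (y::'a::complex_inner))"
  by (rule bounded_linear_intro[where K = "norm y"])
     (auto simp: cinner_add_left cinner_scaleR_left scaleR_conv_of_real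
       intro: order_trans[OF cinner_cauchy_schwarz])

lemma bounded_linear_scaleC: "bounded_linear (\<lambda>x. c *\<^sub>C (x::'a::complex_inner))"
  by (rule bounded_linear_intro[where K = "cmod c"])
     (auto simp: norm_scaleC scaleC_add_right scaleR_scaleC scaleC_scaleC mult.commute)

lemma cinner_eqI: "(\<And>z. cinner z (x::'a::complex_inner) = cinner z y) \<Longrightarrow> x = y"
  using cinner_diff_right[of "x - y" x y] by (simp add: cinner_eq_zero_iff)

section \<open>Bounded complex-linear maps\<close>

lemma cbounded_linear_bounded_linear:
  assumes "cbounded_linear T" shows "bounded_linear T"
proof -
  obtain K where K: "\<And>x. norm (T x) \<le> K * norm x"
    using assms by (auto simp: cbounded_linear_def)
  show ?thesis
    using assms K
    by (intro bounded_linear_intro[where K = K])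
       (auto simp: cbounded_linear_def clinear_def scaleR_scaleC mult.commute)
qed

lemma cbounded_linearI:
  assumes "\<And>x y. T (x + y) = T x + T y" "\<And>c x. T (c *\<^sub>C x) = c *\<^sub>C T x"
    "\<And>x. norm (T x) \<le> K * norm x"
  shows "cbounded_linear T"
  using assms by (auto simp: cbounded_linear_def clinear_def)

lemma clinearD:
  assumes "clinear T"
  shows "T (x + y) = T x + T y" "T (c *\<^sub>C x) = c *\<^sub>C T x" "T (x - y) = T x - T y" "T 0 = 0"
proof -
  show a: "T (x + y) = T x + T y" for x y using assms by (auto simp: clinear_def)
  show "T (c *\<^sub>C x) = c *\<^sub>C T x" using assms by (auto simp: clinear_def)
  show "T (x - y) = T x - T y" using a[of "x - y" y] by simp
  show "T 0 = 0" using a[of 0 0] by simp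
qed

lemma cbounded_linear_clinear: "cbounded_linear T \<Longrightarrow> clinear T"
  by (simp add: cbounded_linear_def)

text \<open>Minimising \<open>\<parallel>x\<parallel>\<^sup>2 - 2 Re (\<phi> x)\<close> over \<open>F\<close> yields the orthogonal projection and the adjoint of a
  map defined only on \<open>F\<close> at once.\<close>

lemma riesz_on_subspace:
  fixes F :: "'a::chilbert_space set" and \<phi> :: "'a \<Rightarrow> complex"
  assumes F: "closed_csubspace F"
    and add: "\<And>x y. x \<in> F \<Longrightarrow> y \<in> F \<Longrightarrow> \<phi> (x + y) = \<phi> x + \<phi> y"
    and scl: "\<And>c x. x \<in> F \<Longrightarrow> \<phi> (c *\<^sub>C x) = c * \<phi> x"
    and bnd: "\<And>x. x \<in> F \<Longrightarrow> cmod (\<phi> x) \<le> K * norm x"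
  shows "\<exists>f\<in>F. \<forall>x\<in>F. \<phi> x = cinner f x"
proof -
  have F0: "0 \<in> F" and Fadd: "\<And>x y. x \<in> F \<Longrightarrow> y \<in> F \<Longrightarrow> x + y \<in> F"
    and Fscl: "\<And>c x. x \<in> F \<Longrightarrow> c *\<^sub>C x \<in> F" and Fcl: "closed F"
    using F by (auto simp: closed_csubspace_def)
  have Fscr: "r *\<^sub>R x \<in> F" "\<phi> (r *\<^sub>R x) = complex_of_real r * \<phi> x" if "x \<in> F" for r :: real and x
    using Fscl that scl by (auto simp: scaleR_scaleC)
  have Fdiff: "x - y \<in> F" and phidiff: "\<phi> (x - y) = \<phi> x - \<phi> y" if "x \<in> F" "y \<in> F" for x y
    using Fadd[OF that(1) Fscr(1)[OF that(2), of "-1"]] add[OF that(1) Fscr(1)[OF that(2), of "-1"]]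
      Fscr(2)[OF that(2), of "-1"] by auto
  define J where "J x = (norm x)\<^sup>2 - 2 * Re (\<phi> x)" for x
  \<comment> \<open>Completing the square in \<open>norm x\<close> bounds \<open>J\<close> below on
    \<open>F\<close>.\<close>
  have lower: "- (K\<^sup>2) \<le> J x" if "x \<in> F" for x
  proof -
    have "Re (\<phi> x) \<le> K * norm x"
      using bnd[OF that] complex_Re_le_cmod order_trans by blast
    moreover have "0 \<le> (norm x - K)\<^sup>2" by simp
    ultimately show ?thesis
      unfolding J_def by (simp add: power2_eq_square algebra_simps)
  qed
  define m where "m = (INF x\<in>F. J x)"
  have bdd: "bdd_below (J ` F)" using lower by (auto intro!: bdd_belowI)
  have mle: "m \<le> J x" if "x \<in> F" for x
    unfolding m_def by (rule cINF_lower[OF bdd that])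
  have "\<exists>x\<in>F. J x < m + 1 / real (Suc n)" for n
    using cINF_less_iff[OF _ bdd, of "m + 1 / real (Suc n)"] F0 by (auto simp: m_def)
  then obtain s where s: "\<And>n. s n \<in> F" "\<And>n. J (s n) < m + 1 / real (Suc n)" by metis
  \<comment> \<open>Parallelogram law: the midpoint lies in \<open>F\<close>, so \<open>J\<close> is
    at least \<open>m\<close> there. This makes every minimising sequence Cauchy.\<close>
  have para: "(norm (x - y))\<^sup>2 \<le> 2 * (J x - m) + 2 * (J y - m)" if "x \<in> F" "y \<in> F" for x y
  proof -
    have "4 * J ((1/2) *\<^sub>R (x + y)) = (norm (x + y))\<^sup>2 - 4 * Re (\<phi> (x + y))"
      using arg_cong[OF Fscr(2)[OF Fadd[OF that], of "1/2"], of Re] by (simp add: J_def power2_eq_square)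
    moreover have "m \<le> J ((1/2) *\<^sub>R (x + y))" by (intro mle Fscr Fadd that)
    ultimately show ?thesis
      by (simp add: norm_diff_sq norm_add_sq add[OF that] J_def)
  qed
  have "Cauchy s"
  proof (rule metric_CauchyI)
    fix e :: real assume "0 < e"
    then obtain N where N: "4 / real (Suc N) < e\<^sup>2"
      using reals_Archimedean[of "e\<^sup>2 / 4"] by (auto simp: field_simps)
    have "dist (s i) (s j) < e" if "i \<ge> N" "j \<ge> N" for i j
    proof -
      have a: "1 / real (Suc i) \<le> 1 / real (Suc N)" "1 / real (Suc j) \<le> 1 / real (Suc N)"
        using that by (auto simp: frac_le)
      have "(norm (s i - s j))\<^sup>2 \<le> 2 * (J (s i) - m) + 2 * (J (s j) - m)" by (rule para[OF s(1) s(1)])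
      also have "\<dots> < 4 / real (Suc N)" using s(2)[of i] s(2)[of j] a by simp
      finally have "(norm (s i - s j))\<^sup>2 < e\<^sup>2" using N by simp
      then show ?thesis using \<open>0 < e\<close> by (simp add: dist_norm power2_less_imp_less)
    qed
    then show "\<exists>M. \<forall>i\<ge>M. \<forall>j\<ge>M. dist (s i) (s j) < e" by blast
  qed
  then obtain f where f: "s \<longlonglongrightarrow> f" using Cauchy_convergent convergent_def by blast
  have fF: "f \<in> F" using closed_sequentially[OF Fcl _ f] s(1) by blast
  have phis: "(\<lambda>n. \<phi> (s n)) \<longlonglongrightarrow> \<phi> f"
  proof (rule Lim_transform)
    show "(\<lambda>n. \<phi> f) \<longlonglongrightarrow> \<phi> f" by simp
    have "(\<lambda>n. s n - f) \<longlonglongrightarrow> 0" using f by (rule LIM_zero)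
    then have "(\<lambda>n. norm (s n - f) * K) \<longlonglongrightarrow> 0"
      by (intro tendsto_mult_left_zero tendsto_norm_zero)
    moreover have "\<forall>\<^sub>F n in sequentially. norm (\<phi> (s n) - \<phi> f) \<le> norm (s n - f) * K"
    proof (intro always_eventually allI)
      fix n
      show "norm (\<phi> (s n) - \<phi> f) \<le> norm (s n - f) * K"
        using bnd[OF Fdiff[OF s(1)[of n] fF]] phidiff[OF s(1)[of n] fF]
        by (simp add: mult.commute)
    qed
    ultimately show "(\<lambda>n. \<phi> (s n) - \<phi> f) \<longlonglongrightarrow> 0"
      by (rule Lim_null_comparison[rotated])
  qed
  have "(\<lambda>n. J (s n)) \<longlonglongrightarrow> J f"
    unfolding J_def by (intro tendsto_intros f phis)
  moreover have "(\<lambda>n. m + 1 / real (Suc n)) \<longlonglongrightarrow> m"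
    using tendsto_add[OF tendsto_const LIMSEQ_Suc[OF lim_1_over_n], of m] by simp
  ultimately have Jf: "J f \<le> m"
    by (rule LIMSEQ_le) (use s(2) less_imp_le in blast)
  have "\<phi> x = cinner f x" if x: "x \<in> F" for x
  proof -
    define d where "d = cinner f x - \<phi> x"
    \<comment> \<open>First variation at the minimiser in direction \<open>x\<close>. The phase of
      \<open>c\<close> turns the linear term into the real number
      \<open>- 2 * t * (cmod d)\<^sup>2\<close>.\<close>
    have var: "0 \<le> t\<^sup>2 * ((cmod d)\<^sup>2 * (norm x)\<^sup>2) - 2 * t * (cmod d)\<^sup>2" for t :: real
    proof -
      define c where "c = - complex_of_real t * cnj d"
      have "J f \<le> J (f + c *\<^sub>C x)" using Jf mle[OF Fadd[OF fF Fscl[OF x]]] by (rule order_trans)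
      then have "0 \<le> (norm (c *\<^sub>C x))\<^sup>2 + 2 * Re (cinner f (c *\<^sub>C x)) - 2 * Re (\<phi> (c *\<^sub>C x))"
        using add[OF fF Fscl[OF x]] by (simp add: J_def norm_add_sq)
      also have "\<dots> = (norm (c *\<^sub>C x))\<^sup>2 + 2 * Re (c * d)"
        by (simp add: cinner_scaleC_right scl[OF x] d_def algebra_simps)
      also have "c * d = - complex_of_real (t * (cmod d)\<^sup>2)"
        unfolding c_def using complex_norm_square[of d] by (simp add: mult_ac)
      also have "norm (c *\<^sub>C x) = \<bar>t\<bar> * cmod d * norm x"
        by (simp add: norm_scaleC c_def norm_mult)
      finally show ?thesis by (simp add: power_mult_distrib mult_ac)
    qed
    show ?thesis
    proof (cases "d = 0")
      case False
      then have p: "(cmod d)\<^sup>2 > 0" by simp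
      \<comment> \<open>Small enough for the linear term to beat the quadratic one; the summand 1
        covers \<open>x = 0\<close>.\<close>
      define t where "t = 1 / (1 + (norm x)\<^sup>2)"
      have q: "1 + (norm x)\<^sup>2 > 0" by (simp add: add_pos_nonneg)
      then have t: "t > 0" "t * (norm x)\<^sup>2 < 1" by (auto simp: t_def)
      have "t\<^sup>2 * ((cmod d)\<^sup>2 * (norm x)\<^sup>2) - 2 * t * (cmod d)\<^sup>2 = t * (cmod d)\<^sup>2 * (t * (norm x)\<^sup>2 - 2)"
        by (simp add: power2_eq_square algebra_simps)
      also have "\<dots> < 0" using t p by (intro mult_pos_neg) auto
      finally show ?thesis using var[of t] by simp
    qed (simp add: d_def)
  qed
  then show ?thesis using fF by blast
qed

section \<open>Positive square roots\<close>

text \<open>Polarisation: a real quadratic form at \<open>x + y\<close> settles the imaginary parts,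
  and at \<open>x + \<i> *\<^sub>C y\<close> the real parts.\<close>

lemma positive_op_selfadjoint:
  assumes "clinear S" "positive_op S"
  shows "cinner (S x) y = cinner x (S y)"
proof -
  have real: "Im (cinner v (S v)) = 0" for v
    using assms(2) by (simp add: positive_op_def)
  have "Im (cinner x (S y)) + Im (cinner y (S x)) = 0"
    using real[of "x + y"] real[of x] real[of y]
    by (simp add: clinearD[OF assms(1)] cinner_add_left cinner_add_right)
  moreover have "Re (cinner x (S y)) = Re (cinner y (S x))"
    using real[of "x + \<i> *\<^sub>C y"] real[of x] real[of y]
    by (simp add: clinearD[OF assms(1)] cinner_add_left cinner_add_right cinner_scaleC_left cinner_scaleC_right)
  ultimately show ?thesis
    using cinner_commute[of "S x" y] by (simp add: complex_eq_iff)
qed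

text \<open>Along \<open>y - t *\<^sub>R S y\<close> the form of \<open>S\<close> equals
  \<open>t\<^sup>2 * k - 2 * t * a\<close>, which is negative for small positive \<open>t\<close>
  unless \<open>a = 0\<close>.\<close>

lemma positive_op_eq_0:
  assumes "clinear S" "positive_op S" "cinner y (S y) = 0"
  shows "S y = 0"
proof -
  define a where "a = (norm (S y))\<^sup>2"
  define k where "k = Re (cinner (S y) (S (S y)))"
  have k: "k \<ge> 0" using assms(2) by (simp add: positive_op_def k_def)
  have "0 \<le> t\<^sup>2 * k - 2 * t * a" for t :: real
  proof -
    have "0 \<le> Re (cinner (y - t *\<^sub>R S y) (S (y - t *\<^sub>R S y)))"
      using assms(2) by (simp add: positive_op_def)
    also have "S (y - t *\<^sub>R S y) = S y - t *\<^sub>R S (S y)"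
      by (simp add: clinearD[OF assms(1)] scaleR_scaleC)
    also have "cinner (y - t *\<^sub>R S y) (S y - t *\<^sub>R S (S y)) =
        of_real (t * t) * cinner (S y) (S (S y)) - 2 * of_real t * cinner (S y) (S y)"
      by (simp add: cinner_diff_left cinner_diff_right cinner_scaleR_left cinner_scaleR_right assms(3)
          positive_op_selfadjoint[OF assms(1,2), symmetric, of y "S y"] algebra_simps)
    finally show ?thesis
      by (simp add: k_def a_def cinner_self power2_eq_square)
  qed
  note nonneg = this
  have "a = 0"
  proof (rule ccontr)
    assume "a \<noteq> 0"
    then have a: "a > 0" by (simp add: a_def)
    define t where "t = a / (k + 1)"
    have t: "t > 0" "t * k < a" using a k by (auto simp: t_def field_simps)
    have "t\<^sup>2 * k - 2 * t * a = t * (t * k - 2 * a)" by (simp add: power2_eq_square algebra_simps)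
    also have "\<dots> < 0" using t a by (intro mult_pos_neg) auto
    finally show False using nonneg[of t] by simp
  qed
  then show ?thesis by (simp add: a_def)
qed

text \<open>For \<open>y = S x - R x\<close>, commutation gives (S + R) y = (S^2 - R^2) x = 0. Two
  nonnegative forms with sum 0 both vanish at \<open>y\<close>, so \<open>S y = R y = 0\<close>, and
  self-adjointness turns \<open>cinner y y\<close> into 0.\<close>

lemma positive_sqrt_unique:
  assumes S: "clinear S" "positive_op S" and R: "clinear R" "positive_op R"
    and sq: "\<And>x. S (S x) = R (R x)" and comm: "\<And>x. S (R x) = R (S x)"
  shows "S x = R x"
proof -
  define y where "y = S x - R x"
  have "S y + R y = 0"
    by (simp add: y_def clinearD[OF S(1)] clinearD[OF R(1)] sq comm)
  then have "cinner y (S y) + cinner y (R y) = 0" by (metis cinner_add_right cinner_zero_right)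
  moreover have "Im (cinner y (S y)) = 0" "Im (cinner y (R y)) = 0"
    "0 \<le> Re (cinner y (S y))" "0 \<le> Re (cinner y (R y))"
    using S(2) R(2) by (auto simp: positive_op_def)
  ultimately have "cinner y (S y) = 0" "cinner y (R y) = 0" by (auto simp: complex_eq_iff)
  then have 0: "S y = 0" "R y = 0" using positive_op_eq_0 S R by auto
  have "cinner y y = cinner (S x) y - cinner (R x) y"
    by (subst (1) y_def) (rule cinner_diff_left)
  also have "\<dots> = cinner x (S y) - cinner x (R y)"
    by (simp add: positive_op_selfadjoint[OF S] positive_op_selfadjoint[OF R])
  finally have "y = 0" by (simp add: 0 cinner_eq_zero_iff)
  then show ?thesis by (simp add: y_def)
qed

text \<open>\<open>sqrt_coeff n\<close> is the coefficient of \<open>t\<^sup>n\<close> in \<open>q = 1 - sqrt (1 - t)\<close>, determined by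
  \<open>2 q = t + q\<^sup>2\<close>.\<close>

fun sqrt_coeff :: "nat \<Rightarrow> real" where
  "sqrt_coeff n = (if n = 0 then 0 else if n = 1 then 1 / 2
     else (\<Sum>i\<in>{1..<n}. sqrt_coeff i * sqrt_coeff (n - i)) / 2)"

declare sqrt_coeff.simps [simp del]

lemma sqrt_coeff_0 [simp]: "sqrt_coeff 0 = 0"
  by (simp add: sqrt_coeff.simps)

lemma sqrt_coeff_nonneg: "0 \<le> sqrt_coeff n"
proof (induction n rule: less_induct)
  case (less n)
  have "0 \<le> (\<Sum>i\<in>{1..<n}. sqrt_coeff i * sqrt_coeff (n - i))"
    by (intro sum_nonneg mult_nonneg_nonneg less) auto
  then show ?case by (subst sqrt_coeff.simps) auto
qed

text \<open>The identity q^2 = 2 q - t in coefficients. The end terms vanish because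
  \<open>sqrt_coeff 0 = 0\<close>, which leaves the sum of the recursion.\<close>

lemma sqrt_coeff_convolution:
  "(\<Sum>i\<le>n. sqrt_coeff i * sqrt_coeff (n - i)) = 2 * sqrt_coeff n - (if n = 1 then 1 else 0)"
proof -
  have "(\<Sum>i\<le>n. sqrt_coeff i * sqrt_coeff (n - i)) = (\<Sum>i\<in>{1..<n}. sqrt_coeff i * sqrt_coeff (n - i))"
    by (rule sum.mono_neutral_right) (auto simp: not_le not_less)
  also have "\<dots> = 2 * sqrt_coeff n - (if n = 1 then 1 else 0)"
    by (subst (3) sqrt_coeff.simps) auto
  finally show ?thesis .
qed

lemma sum_sqrt_coeff_convolution:
  assumes "N \<ge> 2"
  shows "(\<Sum>k<N. \<Sum>i\<le>k. sqrt_coeff i * sqrt_coeff (k - i)) = 2 * (\<Sum>k<N. sqrt_coeff k) - 1"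
  using assms by (simp add: sqrt_coeff_convolution sum_subtractf sum_distrib_left)

text \<open>With s_N the sum over \<open>k < N\<close>, the convolution identity gives 2 s_(N+1) - 1
  \<le> s_N^2 \<le> 1. The triangle \<open>i + j < Suc N\<close> fits into the square of side
  \<open>N\<close> because its remaining points have a zero index, where the product
  vanishes.\<close>

lemma sum_sqrt_coeff_le_1: "(\<Sum>k<N. sqrt_coeff k) \<le> 1"
proof (induction N)
  case (Suc N)
  show ?case
  proof (cases "Suc N \<ge> 2")
    case True
    let ?c = sqrt_coeff
    have "2 * (\<Sum>k<Suc N. ?c k) - 1 = (\<Sum>(i,j)\<in>{(i,j). i + j < Suc N}. ?c i * ?c j)"
      by (simp only: sum_sqrt_coeff_convolution[OF True, symmetric] sum.triangle_reindex)
    also have "\<dots> = (\<Sum>(i,j)\<in>{(i,j). i + j < Suc N} \<inter> {..<N} \<times> {..<N}. ?c i * ?c j)"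
    proof (rule sum.mono_neutral_right)
      show "finite {(i,j). i + j < Suc N}"
        by (rule finite_subset[of _ "{..<Suc N} \<times> {..<Suc N}"]) auto
      show "\<forall>i\<in>{(i, j). i + j < Suc N} - {(i, j). i + j < Suc N} \<inter> {..<N} \<times> {..<N}.
          (case i of (i, j) \<Rightarrow> ?c i * ?c j) = 0"
      proof clarify
        fix i j assume "i + j < Suc N" "(i, j) \<notin> {(i, j). i + j < Suc N} \<inter> {..<N} \<times> {..<N}"
        then have "i = 0 \<or> j = 0" by auto
        then show "?c i * ?c j = 0" by auto
      qed
    qed auto
    also have "\<dots> \<le> (\<Sum>(i,j)\<in>{..<N} \<times> {..<N}. ?c i * ?c j)"
      by (rule sum_mono2) (auto simp: sqrt_coeff_nonneg)
    also have "\<dots> = (\<Sum>k<N. ?c k) * (\<Sum>k<N. ?c k)"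
      by (simp add: sum_product sum.cartesian_product)
    also have "\<dots> \<le> 1 * 1"
      by (intro mult_mono Suc sum_nonneg sqrt_coeff_nonneg) auto
    finally show ?thesis by simp
  next
    case False
    then have "N = 0" by simp
    then show ?thesis by simp
  qed
qed simp

lemma summable_sqrt_coeff: "summable sqrt_coeff"
  by (rule bounded_imp_summable[where B = 1])
    (auto simp: sqrt_coeff_nonneg lessThan_Suc_atMost[symmetric] sum_sqrt_coeff_le_1 simp del: sum.lessThan_Suc)

text \<open>The Cauchy product turns the convolution identity into s^2 = 2 s - 1, whose only root is
  1.\<close>

lemma suminf_sqrt_coeff: "(\<Sum>n. sqrt_coeff n) = 1"
proof -
  let ?s = "\<Sum>n. sqrt_coeff n"
  have "(\<lambda>k. \<Sum>i\<le>k. sqrt_coeff i * sqrt_coeff (k - i)) sums (?s * ?s)"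
    using Cauchy_product_sums[of sqrt_coeff sqrt_coeff] summable_sqrt_coeff
    by (simp add: sqrt_coeff_nonneg)
  moreover have "(\<lambda>k. \<Sum>i\<le>k. sqrt_coeff i * sqrt_coeff (k - i)) sums (2 * ?s - 1)"
    unfolding sqrt_coeff_convolution
    by (intro sums_diff sums_mult summable_sums summable_sqrt_coeff sums_single)
  ultimately have "?s * ?s = 2 * ?s - 1" using sums_unique2 by blast
  then have "(?s - 1)\<^sup>2 = 0" by (simp add: power2_eq_square algebra_simps)
  then show ?thesis by simp
qed

section \<open>The square root of I - T for a self-adjoint contraction T\<close>

locale selfadjoint_contraction =
  fixes T :: "'a::chilbert_space \<Rightarrow> 'a"
  assumes lin: "clinear T" and contr: "norm (T x) \<le> norm x"
    and selfadj: "cinner (T x) y = cinner x (T y)"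
begin

lemma pow_add: "(T ^^ n) (x + y) = (T ^^ n) x + (T ^^ n) y"
  by (induction n) (auto simp: clinearD[OF lin])

lemma pow_scaleC: "(T ^^ n) (c *\<^sub>C x) = c *\<^sub>C (T ^^ n) x"
  by (induction n) (auto simp: clinearD[OF lin])

lemma pow_contr: "norm ((T ^^ n) x) \<le> norm x"
  by (induction n) (auto intro: order_trans[OF contr])

lemma pow_selfadj: "cinner ((T ^^ n) x) y = cinner x ((T ^^ n) y)"
proof (induction n arbitrary: y)
  case (Suc n)
  show ?case by (simp add: selfadj Suc) (simp add: funpow_swap1)
qed simp

lemma pow_scaleR: "(T ^^ n) (r *\<^sub>R x) = r *\<^sub>R (T ^^ n) x"
  by (simp add: scaleR_scaleC pow_scaleC)

lemma pow_bounded_linear: "bounded_linear (T ^^ n)"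
  by (rule bounded_linear_intro[where K = 1]) (auto simp: pow_add pow_scaleR pow_contr)

lemma summable_norm_series: "summable (\<lambda>n. norm (sqrt_coeff n *\<^sub>R (T ^^ n) x))"
  by (rule summable_comparison_test'[OF summable_mult2[OF summable_sqrt_coeff, of "norm x"]])
    (auto simp: sqrt_coeff_nonneg pow_contr mult_left_mono)

lemmas summable_series = summable_norm_cancel[OF summable_norm_series]

text \<open>The series q evaluated at \<open>T\<close>, so that I - Q is the wanted square root of I
  - T.\<close>

definition Q :: "'a \<Rightarrow> 'a" where
  "Q x = (\<Sum>n. sqrt_coeff n *\<^sub>R (T ^^ n) x)"

lemma Q_add: "Q (x + y) = Q x + Q y"
  unfolding Q_def by (simp add: suminf_add[OF summable_series summable_series] pow_add scaleR_add_right)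

lemma Q_scaleC: "Q (c *\<^sub>C x) = c *\<^sub>C Q x"
  unfolding Q_def
  by (subst bounded_linear.suminf[OF bounded_linear_scaleC summable_series])
    (simp add: pow_scaleC scaleR_scaleC scaleC_scaleC mult.commute)

lemma norm_Q: "norm (Q x) \<le> norm x"
proof -
  have "norm (Q x) \<le> (\<Sum>n. norm (sqrt_coeff n *\<^sub>R (T ^^ n) x))"
    unfolding Q_def by (rule summable_norm[OF summable_norm_series])
  also have "\<dots> \<le> (\<Sum>n. sqrt_coeff n * norm x)"
    by (rule suminf_le[OF _ summable_norm_series summable_mult2[OF summable_sqrt_coeff]])
      (auto simp: sqrt_coeff_nonneg pow_contr mult_left_mono)
  also have "\<dots> = norm x"
    by (simp add: suminf_mult2[OF summable_sqrt_coeff, symmetric] suminf_sqrt_coeff)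
  finally show ?thesis .
qed

lemma Q_selfadj: "cinner (Q x) y = cinner x (Q y)"
  unfolding Q_def
  by (simp add: bounded_linear.suminf[OF bounded_linear_cinner_right summable_series]
      bounded_linear.suminf[OF bounded_linear_cinner_left summable_series]
      cinner_scaleR_left cinner_scaleR_right pow_selfadj)

text \<open>Serves the uniqueness of the root: a competing root commutes with \<open>T\<close>, and
  hence with \<open>Q\<close>.\<close>

lemma Q_commute:
  assumes "bounded_linear S" "\<And>x. S (T x) = T (S x)"
  shows "S (Q x) = Q (S x)"
proof -
  have "S ((T ^^ n) x) = (T ^^ n) (S x)" for n
    by (induction n) (auto simp: assms(2))
  then show ?thesis
    unfolding Q_def
    by (simp add: bounded_linear.suminf[OF assms(1) summable_series]
        linear_simps(5)[OF assms(1)])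
qed

text \<open>For the partial sums q_N, the operator q_N(T)^2 is a sum over a square of indices and 2
  q_N(T) - T is its part over the triangle \<open>i + j < N\<close>. The difference has nonnegative
  coefficients and contractive powers, so its norm is controlled by the scalar value (s_N - 1)^2,
  which tends to 0.\<close>

lemma Q_Q: "Q (Q x) = 2 *\<^sub>R Q x - T x"
proof -
  let ?c = sqrt_coeff
  define q where "q N y = (\<Sum>n<N. ?c n *\<^sub>R (T ^^ n) y)" for N y
  define s where "s N = (\<Sum>n<N. ?c n)" for N
  have q_lim: "(\<lambda>N. q N y) \<longlonglongrightarrow> Q y" for y
    unfolding q_def Q_def by (rule summable_LIMSEQ[OF summable_series])
  have s_lim: "s \<longlonglongrightarrow> 1"
    using summable_LIMSEQ[OF summable_sqrt_coeff] by (simp add: s_def[abs_def] suminf_sqrt_coeff)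
  have q_diff: "q N y - q N z = q N (y - z)" for N y z
    by (simp add: q_def sum_subtractf[symmetric] scaleR_diff_right[symmetric] linear_simps(2)[OF pow_bounded_linear])
  have q_norm: "norm (q N y) \<le> norm y" for N y
  proof -
    have "norm (q N y) \<le> (\<Sum>n<N. ?c n * norm y)"
      unfolding q_def by (rule sum_norm_le) (auto simp: sqrt_coeff_nonneg pow_contr mult_left_mono)
    also have "\<dots> = s N * norm y" by (simp add: s_def sum_distrib_right)
    also have "\<dots> \<le> 1 * norm y"
      by (rule mult_right_mono) (auto simp: s_def sum_sqrt_coeff_le_1)
    finally show ?thesis by simp
  qed
  \<comment> \<open>Inner and outer truncation move together; the bound \<open>q_norm\<close>,
    uniform in \<open>N\<close>, separates them.\<close>
  have "(\<lambda>N. q N (q N x - Q x)) \<longlonglongrightarrow> 0"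
    by (rule Lim_null_comparison[OF always_eventually, rule_format, OF q_norm])
      (use tendsto_norm_zero[OF LIM_zero[OF q_lim[of x]]] in simp)
  from tendsto_add[OF this q_lim[of "Q x"]]
  have 1: "(\<lambda>N. q N (q N x)) \<longlonglongrightarrow> Q (Q x)" by (simp add: q_diff[symmetric])
  \<comment> \<open>\<open>N \<ge> 2\<close> ensures that the exceptional index 1 of the convolution
    lies below \<open>N\<close>.\<close>
  have "norm (q N (q N x) - (2 *\<^sub>R q N x - T x)) \<le> (s N - 1)\<^sup>2 * norm x" if N: "N \<ge> 2" for N
  proof -
    let ?A = "{..<N} \<times> {..<N}" and ?B = "{(i,j). i + j < N}"
    have B: "finite ?B" by (rule finite_subset[of _ ?A]) auto
    have BA: "?B \<subseteq> ?A" by auto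
    have "q N (q N x) = (\<Sum>(i,j)\<in>?A. (?c i * ?c j) *\<^sub>R (T ^^ (i + j)) x)"
      by (simp add: q_def sum.cartesian_product[symmetric] bounded_linear.linear linear_sum[OF bounded_linear.linear[OF pow_bounded_linear]]
          scaleR_sum_right pow_scaleR funpow_add)
    moreover have "2 *\<^sub>R q N x - T x = (\<Sum>(i,j)\<in>?B. (?c i * ?c j) *\<^sub>R (T ^^ (i + j)) x)"
    proof -
      have "(\<Sum>(i,j)\<in>?B. (?c i * ?c j) *\<^sub>R (T ^^ (i + j)) x)
          = (\<Sum>k<N. (\<Sum>i\<le>k. ?c i * ?c (k - i)) *\<^sub>R (T ^^ k) x)"
        by (simp add: sum.triangle_reindex scaleR_sum_left)
      also have "\<dots> = 2 *\<^sub>R q N x - (\<Sum>k<N. if k = 1 then T x else 0)"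
        unfolding sqrt_coeff_convolution q_def scaleR_sum_right sum_subtractf[symmetric]
        by (rule sum.cong) (auto simp: scaleR_diff_left)
      finally show ?thesis using N by simp
    qed
    ultimately have "q N (q N x) - (2 *\<^sub>R q N x - T x) = (\<Sum>(i,j)\<in>?A - ?B. (?c i * ?c j) *\<^sub>R (T ^^ (i + j)) x)"
      by (simp add: sum_diff[OF _ BA])
    also have "norm \<dots> \<le> (\<Sum>(i,j)\<in>?A - ?B. ?c i * ?c j * norm x)"
      by (rule sum_norm_le) (auto simp: sqrt_coeff_nonneg intro!: mult_left_mono pow_contr)
    also have "\<dots> = ((\<Sum>(i,j)\<in>?A. ?c i * ?c j) - (\<Sum>(i,j)\<in>?B. ?c i * ?c j)) * norm x"
      by (subst sum_diff[OF _ BA, symmetric]) (auto simp: sum_distrib_right intro!: sum.cong)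
    also have "(\<Sum>(i,j)\<in>?A. ?c i * ?c j) - (\<Sum>(i,j)\<in>?B. ?c i * ?c j) = s N * s N - (2 * s N - 1)"
      by (simp add: s_def sum.cartesian_product[symmetric] sum_product[symmetric] sum.triangle_reindex
          sum_sqrt_coeff_convolution[OF N])
    also have "\<dots> = (s N - 1)\<^sup>2" by (simp add: power2_eq_square algebra_simps)
    finally show ?thesis .
  qed
  then have "\<forall>\<^sub>F N in sequentially. norm (q N (q N x) - (2 *\<^sub>R q N x - T x)) \<le> (s N - 1)\<^sup>2 * norm x"
    by (auto simp: eventually_sequentially)
  moreover have "(\<lambda>N. (s N - 1)\<^sup>2 * norm x) \<longlonglongrightarrow> 0"
    using tendsto_mult_right[OF tendsto_power[OF tendsto_diff[OF s_lim tendsto_const[of 1]], of 2], of "norm x"] by simp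
  ultimately have "(\<lambda>N. q N (q N x) - (2 *\<^sub>R q N x - T x)) \<longlonglongrightarrow> 0"
    by (rule Lim_null_comparison)
  moreover have "(\<lambda>N. q N (q N x) - (2 *\<^sub>R q N x - T x)) \<longlonglongrightarrow> Q (Q x) - (2 *\<^sub>R Q x - T x)"
    by (intro tendsto_intros 1 q_lim)
  ultimately have "Q (Q x) - (2 *\<^sub>R Q x - T x) = 0"
    using LIMSEQ_unique by blast
  then show ?thesis by simp
qed

text \<open>I - Q meets the definite description in \<open>op_sqrt\<close>. Any other root R
  commutes with R^2 = I - T, hence with \<open>T\<close> and \<open>Q\<close>, so
  \<open>positive_sqrt_unique\<close> identifies the two.\<close>

lemma op_sqrt_props:
  fixes D defines "D \<equiv> op_sqrt (\<lambda>x. x - T x)"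
  shows "cbounded_linear D" "positive_op D" "D (D x) = x - T x"
proof -
  define S where "S x = x - Q x" for x
  have "norm (x - Q x) \<le> 2 * norm x" for x
    using norm_triangle_ineq4[of x "Q x"] norm_Q[of x] by linarith
  then have Sb: "cbounded_linear S"
    by (intro cbounded_linearI[where K = 2]) (auto simp: S_def Q_add Q_scaleC scaleC_diff_right)
  have Sl: "clinear S" using Sb by (rule cbounded_linear_clinear)
  have Sp: "positive_op S"
    unfolding positive_op_def
  proof (intro allI conjI)
    fix x
    have "cinner x (Q x) = cnj (cinner x (Q x))"
      using Q_selfadj[of x x] cinner_commute[of "Q x" x] by simp
    then show "Im (cinner x (S x)) = 0"
      by (simp add: S_def cinner_diff_right cinner_self complex_eq_iff)
    have "Re (cinner x (Q x)) \<le> norm x * norm x"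
      using Re_cinner_le[of x "Q x"] mult_left_mono[OF norm_Q[of x], of "norm x"] by simp
    then show "0 \<le> Re (cinner x (S x))"
      by (simp add: S_def cinner_diff_right cinner_self power2_eq_square)
  qed
  have SS: "S (S x) = x - T x" for x
    using Q_add[of "x - Q x" "Q x"] by (simp add: S_def Q_Q scaleR_2 algebra_simps)
  have unique: "R = S" if R: "cbounded_linear R" "positive_op R" "\<forall>x. R (R x) = x - T x" for R
  proof
    fix x
    note Rl = cbounded_linear_clinear[OF R(1)]
    \<comment> \<open>Both sides are R applied three times, bracketed in two ways.\<close>
    have "R (x - T x) = R x - T (R x)" for x by (metis R(3))
    then have "R (T x) = T (R x)" for x by (simp add: clinearD[OF Rl])
    then have RQ: "R (Q x) = Q (R x)" for x
      by (rule Q_commute[OF cbounded_linear_bounded_linear[OF R(1)]])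
    have "R (R x) = S (S x)" for x using R(3) SS by simp
    moreover have "R (S x) = S (R x)" for x
      by (simp add: S_def clinearD(3)[OF Rl] RQ)
    ultimately show "R x = S x" by (rule positive_sqrt_unique[OF Rl R(2) Sl Sp])
  qed
  have "D = S"
    unfolding D_def op_sqrt_def
    by (rule the_equality, intro conjI allI Sb Sp SS, elim conjE, rule unique)
  then show "cbounded_linear D" "positive_op D" "D (D x) = x - T x"
    by (simp_all only: Sb Sp SS)
qed

end

section \<open>Orthogonal projections and Hardy space sequences\<close>

lemma closed_csubspaceD:
  assumes "closed_csubspace F"
  shows "0 \<in> F" "x \<in> F \<Longrightarrow> y \<in> F \<Longrightarrow> x + y \<in> F" "x \<in> F \<Longrightarrow> c *\<^sub>C x \<in> F"
    "x \<in> F \<Longrightarrow> y \<in> F \<Longrightarrow> x - y \<in> F"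
proof -
  show add: "x + y \<in> F" if "x \<in> F" "y \<in> F" for x y using assms that by (auto simp: closed_csubspace_def)
  show scl: "c *\<^sub>C x \<in> F" if "x \<in> F" for c x using assms that by (auto simp: closed_csubspace_def)
  show "0 \<in> F" using assms by (auto simp: closed_csubspace_def)
  show "x - y \<in> F" if "x \<in> F" "y \<in> F"
    using add[OF that(1) scl[OF that(2), of "-1"]] by (simp add: scaleC_minus_one[symmetric])
qed

lemma closed_csubspace_orth_compl: "closed_csubspace (orth_compl F)"
proof -
  have "orth_compl F = (\<Inter>f\<in>F. cinner f -` {0})" by (auto simp: orth_compl_def)
  moreover have "closed (cinner f -` {0})" for f :: 'a
    by (intro closed_vimage closed_singleton linear_continuous_on[OF bounded_linear_cinner_right])
  ultimately have "closed (orth_compl F)" by auto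
  then show ?thesis
    by (auto simp: closed_csubspace_def orth_compl_def cinner_add_right cinner_scaleC_right)
qed

lemma proj_unique:
  assumes F: "closed_csubspace F"
    and p: "p \<in> F" "\<And>f. f \<in> F \<Longrightarrow> cinner f (x - p) = 0"
    and q: "q \<in> F" "\<And>f. f \<in> F \<Longrightarrow> cinner f (x - q) = 0"
  shows "p = q"
proof -
  have "cinner (p - q) (x - q) - cinner (p - q) (x - p) = 0"
    using p q closed_csubspaceD[OF F] by simp
  then have "cinner (p - q) (p - q) = 0" by (simp add: cinner_diff_right)
  then show ?thesis by (simp add: cinner_eq_zero_iff)
qed

text \<open>Representing the functional \<open>cinner x\<close> on \<open>F\<close> by an element of
  \<open>F\<close> produces the projection of \<open>x\<close>.\<close>

lemma proj_props:
  assumes F: "closed_csubspace F"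
  shows "proj F x \<in> F \<and> (\<forall>f\<in>F. cinner f (x - proj F x) = 0)"
proof -
  have "\<exists>p\<in>F. \<forall>y\<in>F. cinner x y = cinner p y"
    by (rule riesz_on_subspace[OF F, where K = "norm x"])
      (auto simp: cinner_add_right cinner_scaleC_right cinner_cauchy_schwarz)
  then obtain p where p: "p \<in> F" "\<And>y. y \<in> F \<Longrightarrow> cinner x y = cinner p y" by blast
  have *: "cinner f (x - p) = 0" if "f \<in> F" for f
    using p(2)[OF that] cinner_commute[of f "x - p"] by (simp add: cinner_diff_left)
  show ?thesis
    unfolding proj_def
  proof (rule theI[where a = p])
    show "p \<in> F \<and> (\<forall>f\<in>F. cinner f (x - p) = 0)" using p(1) * by blast
    show "q = p" if "q \<in> F \<and> (\<forall>f\<in>F. cinner f (x - q) = 0)" for q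
      using proj_unique[OF F _ _ p(1) *] that by blast
  qed
qed

lemma proj_eqI:
  assumes "closed_csubspace F" "p \<in> F" "\<And>f. f \<in> F \<Longrightarrow> cinner f (x - p) = 0"
  shows "proj F x = p"
  using proj_unique[OF assms(1)] proj_props[OF assms(1)] assms(2,3) by blast

lemma proj_ident: "closed_csubspace F \<Longrightarrow> x \<in> F \<Longrightarrow> proj F x = x"
  by (intro proj_eqI) auto

lemma cinner_proj:
  assumes "closed_csubspace F" "f \<in> F"
  shows "cinner f (proj F x) = cinner f x" "cinner (proj F x) f = cinner x f"
proof -
  show *: "cinner f (proj F x) = cinner f x"
    using proj_props[OF assms(1), of x] assms(2) by (auto simp: cinner_diff_right)
  then show "cinner (proj F x) f = cinner x f"
    using cinner_commute[of "proj F x" f] cinner_commute[of x f] by simp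
qed

lemma proj_add: "closed_csubspace F \<Longrightarrow> proj F (x + y) = proj F x + proj F y"
  by (intro proj_eqI)
    (auto simp: closed_csubspaceD proj_props cinner_diff_right cinner_add_right cinner_proj)

lemma proj_scaleC: "closed_csubspace F \<Longrightarrow> proj F (c *\<^sub>C x) = c *\<^sub>C proj F x"
  by (intro proj_eqI)
    (auto simp: closed_csubspaceD proj_props cinner_diff_right cinner_scaleC_right cinner_proj)

lemma norm_proj_pythagoras:
  assumes "closed_csubspace F"
  shows "(norm x)\<^sup>2 = (norm (proj F x))\<^sup>2 + (norm (x - proj F x))\<^sup>2"
  using norm_add_sq[of "proj F x" "x - proj F x"] proj_props[OF assms, of x] by simp

lemma norm_proj: "closed_csubspace F \<Longrightarrow> norm (proj F x) \<le> norm x"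
  by (rule power2_le_imp_le) (simp_all add: norm_proj_pythagoras[of F x])

lemma proj_orth_compl:
  assumes "closed_csubspace F"
  shows "proj (orth_compl F) x = x - proj F x"
proof (rule proj_eqI[OF closed_csubspace_orth_compl])
  show "x - proj F x \<in> orth_compl F" using proj_props[OF assms, of x] by (auto simp: orth_compl_def)
  show "cinner f (x - (x - proj F x)) = 0" if "f \<in> orth_compl F" for f
    using that proj_props[OF assms, of x] cinner_commute[of f "proj F x"] by (auto simp: orth_compl_def)
qed

section \<open>Vector-valued power series in the disc\<close>

text \<open>Stated for bounded coefficients rather than for \<open>H2\<close>, because the state
  sequences below are only known to be bounded.\<close>

lemma summable_geometric_scaleC:
  fixes a :: "nat \<Rightarrow> 'a::chilbert_space"
  assumes "\<And>n. norm (a n) \<le> K" "cmod z < 1"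
  shows "summable (\<lambda>n. norm ((z ^ n) *\<^sub>C a n))"
proof (rule summable_comparison_test')
  show "summable (\<lambda>n. cmod z ^ n * K)" using assms(2) by (intro summable_mult2 summable_geometric) simp
  show "norm (norm ((z ^ n) *\<^sub>C a n)) \<le> cmod z ^ n * K" for n
    using assms(1) by (auto simp: norm_scaleC norm_power intro!: mult_left_mono)
qed

lemmas summable_h2_eval = summable_norm_cancel[OF summable_geometric_scaleC]

lemma h2_eval_linear:
  assumes T: "cbounded_linear T" and a: "\<And>n. norm (a n) \<le> K" and z: "cmod z < 1"
  shows "T (h2_eval a z) = h2_eval (\<lambda>n. T (a n)) z"
  unfolding h2_eval_def
  by (simp add: bounded_linear.suminf[OF cbounded_linear_bounded_linear[OF T] summable_h2_eval[OF a z]]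
      clinearD[OF cbounded_linear_clinear[OF T]])

lemma h2_eval_add:
  assumes "\<And>n. norm (a n) \<le> K" "\<And>n. norm (b n) \<le> L" "cmod z < 1"
  shows "h2_eval (\<lambda>n. a n + b n) z = h2_eval a z + h2_eval b z"
  unfolding h2_eval_def
  unfolding scaleC_add_right
  by (rule suminf_add[symmetric]) (rule summable_h2_eval, rule assms, rule assms)+

lemma h2_eval_shift:
  assumes "\<And>n. norm (a n) \<le> K" "cmod z < 1"
  shows "h2_eval a z = a 0 + z *\<^sub>C h2_eval (\<lambda>n. a (Suc n)) z"
proof -
  have "h2_eval a z = a 0 + (\<Sum>n. (z ^ Suc n) *\<^sub>C a (Suc n))"
    unfolding h2_eval_def using suminf_split_head[OF summable_h2_eval[of a K z]] assms by (simp add: scaleC_one)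
  also have "(\<lambda>n. (z ^ Suc n) *\<^sub>C a (Suc n)) = (\<lambda>n. z *\<^sub>C ((z ^ n) *\<^sub>C a (Suc n)))"
    by (simp add: scaleC_scaleC)
  also have "(\<Sum>n. z *\<^sub>C ((z ^ n) *\<^sub>C a (Suc n))) = z *\<^sub>C h2_eval (\<lambda>n. a (Suc n)) z"
    unfolding h2_eval_def
    by (rule bounded_linear.suminf[OF bounded_linear_scaleC, symmetric]) (rule summable_h2_eval, rule assms, rule assms)
  finally show ?thesis .
qed

lemma norm_h2_eval_le:
  assumes "\<And>n. norm (a n) \<le> K" "cmod z \<le> 1 / 2"
  shows "norm (h2_eval a z) \<le> 2 * K"
proof -
  have z: "cmod z < 1" using assms(2) by simp
  have "norm (h2_eval a z) \<le> (\<Sum>n. norm ((z ^ n) *\<^sub>C a n))"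
    unfolding h2_eval_def by (rule summable_norm[OF summable_geometric_scaleC[OF assms(1) z]])
  also have "\<dots> \<le> (\<Sum>n. (1 / 2) ^ n * K)"
    using assms(2)
    by (intro suminf_le summable_geometric_scaleC[OF assms(1) z] summable_mult2 summable_geometric)
      (auto simp: norm_scaleC norm_power intro!: mult_mono power_mono assms(1))
  also have "\<dots> = 2 * K"
    by (simp add: suminf_mult2[symmetric] suminf_geometric summable_geometric)
  finally show ?thesis .
qed

text \<open>Letting real \<open>t\<close> decrease to 0 kills the constant term; dividing by
  \<open>z\<close> passes to the shifted sequence and the argument repeats. The division loses the
  point 0, so the hypothesis is restricted to nonzero \<open>z\<close>.\<close>

lemma h2_eval_eq_0_imp:
  assumes a: "\<And>n. norm (a n) \<le> K" and 0: "\<And>z. z \<noteq> 0 \<Longrightarrow> cmod z < 1 \<Longrightarrow> h2_eval a z = 0"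
  shows "a k = 0"
proof -
  have head: "b 0 = 0" if b: "\<And>n. norm (b n) \<le> K" and b0: "\<And>z. z \<noteq> 0 \<Longrightarrow> cmod z < 1 \<Longrightarrow> h2_eval b z = 0" for b
  proof -
    have "norm (b 0) \<le> t * (2 * K)" if t: "0 < t" "t < 1 / 2" for t :: real
    proof -
      have "h2_eval b (of_real t) = b 0 + of_real t *\<^sub>C h2_eval (\<lambda>n. b (Suc n)) (of_real t)"
        by (rule h2_eval_shift[OF b]) (use t in simp)
      moreover have "h2_eval b (of_real t) = 0" by (rule b0) (use t in simp_all)
      ultimately have "b 0 = - (of_real t *\<^sub>C h2_eval (\<lambda>n. b (Suc n)) (of_real t))"
        by (simp only: eq_neg_iff_add_eq_0)
      then have "norm (b 0) = t * norm (h2_eval (\<lambda>n. b (Suc n)) (of_real t))"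
        using t by (simp add: norm_scaleC)
      also have "\<dots> \<le> t * (2 * K)"
        using t by (intro mult_left_mono norm_h2_eval_le b) auto
      finally show ?thesis .
    qed
    then have ev: "\<forall>\<^sub>F t in at_right 0. norm (b 0) \<le> t * (2 * K)"
      by (auto simp: eventually_at_right_field intro!: exI[of _ "1 / 2"])
    have "((\<lambda>t. t * (2 * K)) \<longlongrightarrow> 0 * (2 * K)) (at_right 0)" by (intro tendsto_intros)
    from tendsto_le[OF trivial_limit_at_right_real this tendsto_const ev] show ?thesis by simp
  qed
  have "\<forall>z. z \<noteq> 0 \<longrightarrow> cmod z < 1 \<longrightarrow> h2_eval (\<lambda>n. a (n + k)) z = 0"
  proof (induction k)
    case (Suc k)
    have "a k = 0" using head[of "\<lambda>n. a (n + k)"] a Suc by auto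
    show ?case
    proof (intro allI impI)
      fix z :: complex assume z: "z \<noteq> 0" "cmod z < 1"
      have "z *\<^sub>C h2_eval (\<lambda>n. a (n + Suc k)) z = 0"
        using Suc z h2_eval_shift[of "\<lambda>n. a (n + k)" K z] a \<open>a k = 0\<close> by simp
      then have "norm (z *\<^sub>C h2_eval (\<lambda>n. a (n + Suc k)) z) = 0" by simp
      then show "h2_eval (\<lambda>n. a (n + Suc k)) z = 0" using z by (simp add: norm_scaleC)
    qed
  qed (use 0 in simp)
  then show ?thesis using head[of "\<lambda>n. a (n + k)"] a by auto
qed

lemma H2_bounded:
  assumes "a \<in> H2 Z"
  shows "norm (a n) \<le> sqrt (\<Sum>n. (norm (a n))\<^sup>2)"
proof -
  have "(norm (a n))\<^sup>2 \<le> (\<Sum>n. (norm (a n))\<^sup>2)"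
    using sum_le_suminf[of "\<lambda>n. (norm (a n))\<^sup>2" "{n}"] assms by (auto simp: H2_def)
  then show ?thesis by (simp add: real_le_rsqrt)
qed

text \<open>Uniqueness of Taylor coefficients; it makes the descriptions in \<open>mult_op\<close>
  and \<open>gamma_op\<close> determinate.\<close>

lemma H2_eqI:
  assumes "a \<in> H2 Z" "b \<in> H2 Z'" "\<And>z. cmod z < 1 \<Longrightarrow> h2_eval a z = h2_eval b z"
  shows "a = b"
proof
  fix k
  obtain K L where K: "\<And>n. norm (a n) \<le> K" "\<And>n. norm (b n) \<le> L"
    using H2_bounded assms(1,2) by metis
  have neg: "cbounded_linear (uminus :: 'a \<Rightarrow> 'a)"
    by (rule cbounded_linearI[where K = 1]) (auto simp: scaleC_minus_one scaleC_add_right scaleC_scaleC norm_scaleC mult.commute)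
  have "a k + - b k = 0"
  proof (rule h2_eval_eq_0_imp)
    show "norm (a n + - b n) \<le> K + L" for n
      using norm_triangle_ineq4[of "a n" "b n"] K(1)[of n] K(2)[of n] by simp
    show "h2_eval (\<lambda>n. a n + - b n) z = 0" if "cmod z < 1" for z
      using assms(3)[OF that] h2_eval_linear[of uminus b L z, OF neg K(2) that, symmetric]
      by (subst h2_eval_add[OF K(1) _ that, where L = L]) (use K(2) in auto)
  qed
  then show "a k = b k" by simp
qed

lemma mult_op_eqI:
  assumes "g \<in> H2 UNIV" "\<And>z. cmod z < 1 \<Longrightarrow> h2_eval g z = \<Phi> z (h2_eval f z)"
  shows "mult_op \<Phi> f = g"
  unfolding mult_op_def using assms by (intro the_equality) (auto intro: H2_eqI)

lemma gamma_op_eqI: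
  assumes "g \<in> H2 UNIV" "\<And>z. cmod z < 1 \<Longrightarrow> h2_eval g z = H z u"
  shows "gamma_op H u = g"
  unfolding gamma_op_def using assms by (intro the_equality) (auto intro: H2_eqI)

lemma summable_h2_inner:
  assumes "summable (\<lambda>n. (norm (a n))\<^sup>2)" "summable (\<lambda>n. (norm (b n))\<^sup>2)"
  shows "summable (\<lambda>n. cinner (a n) (b n :: 'a::chilbert_space))"
proof (rule summable_comparison_test')
  show "summable (\<lambda>n. (norm (a n))\<^sup>2 + (norm (b n))\<^sup>2)" using assms by (rule summable_add)
  fix n
  have "norm (cinner (a n) (b n)) \<le> norm (a n) * norm (b n)" by (rule cinner_cauchy_schwarz)
  also have "\<dots> \<le> (norm (a n))\<^sup>2 + (norm (b n))\<^sup>2"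
    using sum_squares_bound[of "norm (a n)" "norm (b n)"]
      mult_nonneg_nonneg[OF norm_ge_zero norm_ge_zero, of "a n" "b n"] by linarith
  finally show "norm (cinner (a n) (b n)) \<le> (norm (a n))\<^sup>2 + (norm (b n))\<^sup>2" .
qed

section \<open>The forward system\<close>

lemma norm_prod_sq: "(norm (x, y))\<^sup>2 = (norm x)\<^sup>2 + (norm y)\<^sup>2"
  by (simp add: norm_prod_def)

lemma cinner_Pair: "cinner (a, b) (c, d) = cinner a c + cinner b d"
  by (simp add: cinner_prod_def)

lemma cbounded_linear_compose:
  assumes "cbounded_linear S" "cbounded_linear T"
  shows "cbounded_linear (\<lambda>x. S (T x))"
proof -
  obtain K where K: "\<And>x. norm (S x) \<le> K * norm x" using assms(1) by (auto simp: cbounded_linear_def)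
  obtain L where L: "\<And>x. norm (T x) \<le> L * norm x" using assms(2) by (auto simp: cbounded_linear_def)
  have "norm (S (T x)) \<le> \<bar>K\<bar> * L * norm x" for x
  proof -
    have "norm (S (T x)) \<le> K * norm (T x)" by (rule K)
    also have "\<dots> \<le> \<bar>K\<bar> * norm (T x)" by (rule mult_right_mono) auto
    also have "\<dots> \<le> \<bar>K\<bar> * (L * norm x)" by (rule mult_left_mono[OF L]) auto
    finally show ?thesis by (simp add: mult.assoc)
  qed
  then show ?thesis
    by (rule cbounded_linearI[rotated 2])
      (simp_all add: clinearD[OF cbounded_linear_clinear[OF assms(1)]] clinearD[OF cbounded_linear_clinear[OF assms(2)]])
qed

lemma norm_fst_le_prod: "norm (fst p) \<le> norm p" and norm_snd_le_prod: "norm (snd p) \<le> norm p"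
  using norm_fst_le[of "fst p" "snd p"] norm_snd_le[of "snd p" "fst p"] by simp_all

lemma cbounded_linear_fst: "cbounded_linear fst"
  by (rule cbounded_linearI[where K = 1]) (simp_all add: scaleC_prod_def norm_fst_le_prod)

lemma cbounded_linear_snd: "cbounded_linear snd"
  by (rule cbounded_linearI[where K = 1]) (simp_all add: scaleC_prod_def norm_snd_le_prod)

section \<open>The contraction \<omega>, its adjoint and its defect operator\<close>

locale omega_setting =
  fixes F :: "'u::chilbert_space set"
    and \<omega>1 :: "'u \<Rightarrow> 'y::chilbert_space"
    and \<omega>2 :: "'u \<Rightarrow> 'u"
  assumes F: "closed_csubspace F" and contr: "omega_contraction F \<omega>1 \<omega>2"
begin

abbreviation P :: "'u \<Rightarrow> 'u" where "P \<equiv> proj F"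
abbreviation adj :: "'y \<times> 'u \<Rightarrow> 'u" where "adj \<equiv> omega_adj F \<omega>1 \<omega>2"
abbreviation D :: "'y \<times> 'u \<Rightarrow> 'y \<times> 'u" where "D \<equiv> defect_adj F \<omega>1 \<omega>2"

text \<open>\<omega> is only meaningful on \<open>F\<close>; composing with the projection extends
  it by 0 to a linear contraction on the whole space.\<close>

definition W :: "'u \<Rightarrow> 'y \<times> 'u" where "W x = (\<omega>1 (P x), \<omega>2 (P x))"

lemma P_in: "P x \<in> F" and P_orth: "f \<in> F \<Longrightarrow> cinner f (x - P x) = 0"
  using proj_props[OF F] by auto

lemma norm_W_P: "norm (W x) \<le> norm (P x)"
proof (rule power2_le_imp_le)
  show "(norm (W x))\<^sup>2 \<le> (norm (P x))\<^sup>2"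
    using contr P_in[of x] by (simp add: W_def norm_prod_sq omega_contraction_def)
qed simp

lemma norm_W: "norm (W x) \<le> norm x"
  using norm_W_P norm_proj[OF F] order_trans by blast

lemma W_cbounded_linear: "cbounded_linear W"
proof (rule cbounded_linearI[where K = 1])
  show "W (x + y) = W x + W y" for x y
    using contr P_in by (simp add: W_def proj_add[OF F] omega_contraction_def)
  show "W (c *\<^sub>C x) = c *\<^sub>C W x" for c x
    using contr P_in by (simp add: W_def proj_scaleC[OF F] omega_contraction_def scaleC_prod_def)
qed (simp add: norm_W)

lemmas W_lin = clinearD[OF cbounded_linear_clinear[OF W_cbounded_linear]]

text \<open>Existence is \<open>riesz_on_subspace\<close> for the functional sending
  \<open>x\<close> to \<open>cinner p (W x)\<close>; two candidates are compared by testing with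
  their difference, which lies in \<open>F\<close>.\<close>

lemma adj_props: "adj p \<in> F \<and> (\<forall>g\<in>F. cinner (\<omega>1 g, \<omega>2 g) p = cinner g (adj p))"
proof -
  have W: "(\<omega>1 g, \<omega>2 g) = W g" if "g \<in> F" for g using that by (simp add: W_def proj_ident[OF F])
  have "\<exists>f\<in>F. \<forall>x\<in>F. cinner p (W x) = cinner f x"
  proof (rule riesz_on_subspace[OF F, where K = "norm p"])
    fix x :: 'u
    have "cmod (cinner p (W x)) \<le> norm p * norm (W x)" by (rule cinner_cauchy_schwarz)
    also have "\<dots> \<le> norm p * norm x" by (intro mult_left_mono norm_W) simp
    finally show "cmod (cinner p (W x)) \<le> norm p * norm x" .
  qed (simp_all add: W_lin cinner_add_right cinner_scaleC_right)
  then obtain f where f: "f \<in> F" "\<And>x. x \<in> F \<Longrightarrow> cinner p (W x) = cinner f x" by blast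
  have fW: "cinner (W g) p = cinner g f" if "g \<in> F" for g
    using f(2)[OF that] cinner_commute[of "W g" p] cinner_commute[of g f] by simp
  show ?thesis
    unfolding omega_adj_def
  proof (rule theI[where a = f])
    show "f \<in> F \<and> (\<forall>g\<in>F. cinner (\<omega>1 g, \<omega>2 g) p = cinner g f)" using f(1) fW W by simp
    fix h assume h: "h \<in> F \<and> (\<forall>g\<in>F. cinner (\<omega>1 g, \<omega>2 g) p = cinner g h)"
    then have "h - f \<in> F" using f(1) closed_csubspaceD[OF F] by blast
    then have "cinner (h - f) h = cinner (h - f) f" using h fW[of "h - f"] W by simp
    then have "cinner (h - f) (h - f) = 0" by (simp add: cinner_diff_right)
    then show "h = f" by (simp add: cinner_eq_zero_iff)
  qed
qed

lemma adj_in: "adj p \<in> F"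
  using adj_props by blast

text \<open>\<open>W\<close> factors through the projection and \<open>adj\<close> takes values in
  \<open>F\<close>, so adjointness on \<open>F\<close> extends to all of the space.\<close>

lemma cinner_W: "cinner (W x) p = cinner x (adj p)"
  using adj_props[of p] P_in[of x] cinner_proj(2)[OF F adj_in, of x p] by (simp add: W_def)

lemma cinner_adj: "cinner (adj p) x = cinner p (W x)"
  using cinner_W[of x p] cinner_commute[of "adj p" x] cinner_commute[of p "W x"] by simp

lemma norm_adj: "norm (adj p) \<le> norm p"
proof -
  have "norm (adj p) * norm (adj p) = Re (cinner p (W (adj p)))"
    by (simp add: cinner_adj[symmetric] cinner_self power2_eq_square)
  also have "\<dots> \<le> norm p * norm (adj p)"
    using Re_cinner_le[of p "W (adj p)"] mult_left_mono[OF norm_W[of "adj p"], of "norm p"] by simp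
  finally show ?thesis
    by (cases "adj p = 0") (simp_all add: mult_le_cancel_right)
qed

lemma adj_cbounded_linear: "cbounded_linear adj"
proof (rule cbounded_linearI[where K = 1])
  show "adj (x + y) = adj x + adj y" for x y
    by (rule cinner_eqI) (simp add: cinner_W[symmetric] cinner_add_right)
  show "adj (c *\<^sub>C x) = c *\<^sub>C adj x" for c x
    by (rule cinner_eqI) (simp add: cinner_W[symmetric] cinner_scaleC_right)
qed (simp add: norm_adj)

lemmas adj_lin = clinearD[OF cbounded_linear_clinear[OF adj_cbounded_linear]]

lemma P_adj [simp]: "P (adj p) = adj p"
  by (rule proj_ident[OF F adj_in])

lemma P_orth_compl: "g \<in> orth_compl F \<Longrightarrow> P g = 0"
  using proj_eqI[OF F closed_csubspaceD(1)[OF F], of g] cinner_commute[of _ g]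
  by (auto simp: orth_compl_def)

text \<open>\<omega> times its adjoint is a self-adjoint contraction, so the square-root
  construction applies to it.\<close>

lemma D_props: "cbounded_linear D" "positive_op D" "D (D p) = p - W (adj p)"
proof -
  interpret selfadjoint_contraction "\<lambda>p. W (adj p)"
  proof
    show "clinear (\<lambda>p. W (adj p))" by (simp add: clinear_def adj_lin W_lin)
    show "norm (W (adj x)) \<le> norm x" for x using norm_W norm_adj order_trans by blast
    show "cinner (W (adj x)) y = cinner x (W (adj y))" for x y
      by (simp add: cinner_W cinner_adj)
  qed
  have "D = op_sqrt (\<lambda>p. p - W (adj p))"
    by (simp add: defect_adj_def W_def)
  then show "cbounded_linear D" "positive_op D" "D (D p) = p - W (adj p)"
    using op_sqrt_props by simp_all
qed

lemmas D_lin = clinearD[OF cbounded_linear_clinear[OF D_props(1)]]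
lemmas D_selfadj = positive_op_selfadjoint[OF cbounded_linear_clinear[OF D_props(1)] D_props(2)]

text \<open>The column (\<open>adj\<close>, \<open>D\<close>) is isometric, since the squares of its
  entries add up to the identity.\<close>

lemma norm_adj_D: "(norm (adj p))\<^sup>2 + (norm (D p))\<^sup>2 = (norm p)\<^sup>2"
proof -
  have "cinner (adj p) (adj p) + cinner (D p) (D p) = cinner p p"
    by (simp add: D_selfadj D_props(3) cinner_adj cinner_diff_right)
  from arg_cong[OF this, of Re] show ?thesis by (simp add: cinner_self del: of_real_power)
qed

lemma norm_D: "norm (D p) \<le> norm p"
  by (rule power2_le_imp_le) (simp_all add: norm_adj_D[of p, symmetric])

text \<open>The row \<open>(\<omega> P, D)\<close> is a co-isometry, hence a contraction.\<close>

lemma norm_row: "(norm (W x + D f))\<^sup>2 \<le> (norm (P x))\<^sup>2 + (norm f)\<^sup>2"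
proof -
  define q where "q = W x + D f"
  \<comment> \<open>Pairing \<open>q\<close> with itself moves the row onto the isometric column
    \<open>(adj q, D q)\<close>; Cauchy-Schwarz then allows one factor \<open>norm q\<close> to be
    cancelled.\<close>
  have "complex_of_real ((norm q)\<^sup>2) = cinner (P x) (adj q) + cinner f (D q)"
    using cinner_W[of x q] cinner_proj(2)[OF F adj_in, of x q]
    by (simp add: cinner_self[symmetric] D_selfadj[symmetric] del: of_real_power)
      (simp add: q_def cinner_add_left)
  also have "\<dots> = cinner (P x, f) (adj q, D q)" by (simp add: cinner_Pair)
  finally have "complex_of_real ((norm q)\<^sup>2) = cinner (P x, f) (adj q, D q)" .
  then have "(norm q)\<^sup>2 = Re (cinner (P x, f) (adj q, D q))" by (metis Re_complex_of_real)
  also have "\<dots> \<le> norm (P x, f) * norm (adj q, D q)" by (rule Re_cinner_le)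
  also have "norm (adj q, D q) = norm q" using norm_adj_D[of q] by (simp add: norm_prod_def)
  finally have "norm q \<le> norm (P x, f)"
    by (cases "q = 0") (simp_all add: power2_eq_square)
  then show ?thesis by (simp add: q_def norm_prod_sq[symmetric] power_mono)
qed

primrec state :: "'u \<Rightarrow> (nat \<Rightarrow> 'y \<times> 'u) \<Rightarrow> nat \<Rightarrow> 'u" where
  "state u f 0 = u"
| "state u f (Suc n) = snd (W (state u f n) + D (f n))"

text \<open>The projection onto the orthogonal complement of \<open>F\<close>, written as I - P (see
  \<open>proj_orth_compl\<close>).\<close>

definition out1 :: "'u \<Rightarrow> (nat \<Rightarrow> 'y \<times> 'u) \<Rightarrow> nat \<Rightarrow> 'u" where
  "out1 u f n = state u f n - P (state u f n)"

definition out2 :: "'u \<Rightarrow> (nat \<Rightarrow> 'y \<times> 'u) \<Rightarrow> nat \<Rightarrow> 'y" where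
  "out2 u f n = fst (W (state u f n) + D (f n))"

lemma out2_state: "(out2 u f n, state u f (Suc n)) = W (state u f n) + D (f n)"
  by (simp add: out2_def prod_eq_iff)

lemma state_add: "state (u + u') (\<lambda>n. f n + f' n) n = state u f n + state u' f' n"
  by (induction n) (simp_all add: W_lin D_lin)

text \<open>Dissipation: Pythagoras splits the old state into \<open>out1\<close> and its part in
  \<open>F\<close>, and \<open>norm_row\<close> bounds what that part and the input produce.\<close>

lemma energy_step:
  "(norm (out1 u f n))\<^sup>2 + (norm (out2 u f n))\<^sup>2 + (norm (state u f (Suc n)))\<^sup>2
    \<le> (norm (state u f n))\<^sup>2 + (norm (f n))\<^sup>2"
  using norm_row[of "state u f n" "f n"] norm_proj_pythagoras[OF F, of "state u f n"]
  by (simp add: out1_def out2_state[symmetric] norm_prod_sq del: state.simps)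

lemma energy_sum:
  "(\<Sum>n<N. (norm (out1 u f n))\<^sup>2 + (norm (out2 u f n))\<^sup>2) + (norm (state u f N))\<^sup>2
    \<le> (norm u)\<^sup>2 + (\<Sum>n<N. (norm (f n))\<^sup>2)"
proof (induction N)
  case (Suc N)
  then show ?case using energy_step[of u f N] by (simp del: state.simps)
qed simp

lemma energy_bound:
  assumes "f \<in> H2 Z"
  shows "(\<Sum>n<N. (norm (out1 u f n))\<^sup>2 + (norm (out2 u f n))\<^sup>2) + (norm (state u f N))\<^sup>2
    \<le> (norm u)\<^sup>2 + (\<Sum>n. (norm (f n))\<^sup>2)"
proof -
  have "(\<Sum>n<N. (norm (f n))\<^sup>2) \<le> (\<Sum>n. (norm (f n))\<^sup>2)"
    using assms by (intro sum_le_suminf) (auto simp: H2_def)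
  then show ?thesis using energy_sum[of u f N] by linarith
qed

lemma norm_state_le:
  assumes "f \<in> H2 Z"
  shows "norm (state u f N) \<le> sqrt ((norm u)\<^sup>2 + (\<Sum>n. (norm (f n))\<^sup>2))"
proof (rule real_le_rsqrt)
  have "0 \<le> (\<Sum>n<N. (norm (out1 u f n))\<^sup>2 + (norm (out2 u f n))\<^sup>2)"
    by (intro sum_nonneg) simp
  then show "(norm (state u f N))\<^sup>2 \<le> (norm u)\<^sup>2 + (\<Sum>n. (norm (f n))\<^sup>2)"
    using energy_bound[OF assms, of u N] by linarith
qed

lemma out_H2:
  assumes "f \<in> H2 Z"
  shows "out1 u f \<in> H2 (orth_compl F)" "out2 u f \<in> H2 UNIV"
proof -
  have le: "(\<Sum>n<N. (norm (out1 u f n))\<^sup>2 + (norm (out2 u f n))\<^sup>2) \<le> (norm u)\<^sup>2 + (\<Sum>n. (norm (f n))\<^sup>2)" for N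
    using energy_bound[OF assms, of u N] zero_le_power2[of "norm (state u f N)"] by linarith
  have s: "summable (\<lambda>n. (norm (out1 u f n))\<^sup>2 + (norm (out2 u f n))\<^sup>2)"
    by (rule bounded_imp_summable[where B = "(norm u)\<^sup>2 + (\<Sum>n. (norm (f n))\<^sup>2)"])
      (use le in \<open>auto simp: lessThan_Suc_atMost[symmetric] simp del: sum.lessThan_Suc\<close>)
  have "summable (\<lambda>n. (norm (out1 u f n))\<^sup>2)" "summable (\<lambda>n. (norm (out2 u f n))\<^sup>2)"
    by (rule summable_comparison_test'[OF s]; simp)+
  moreover have "out1 u f n \<in> orth_compl F" for n
    by (auto simp: out1_def orth_compl_def P_orth)
  ultimately show "out1 u f \<in> H2 (orth_compl F)" "out2 u f \<in> H2 UNIV"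
    by (auto simp: H2_def)
qed

section \<open>Transfer functions as outputs of the forward system\<close>

text \<open>Only injectivity of I - z A needs an argument, and it follows from
  \<open>cmod z < 1\<close> and contractivity. Preimages come later from explicit power
  series.\<close>

lemma resolv_eqI:
  assumes "cmod z < 1" "x - z *\<^sub>C snd (W x) = y"
  shows "resolv F \<omega>2 z y = x"
proof -
  have unique: "x' = x" if "x' - z *\<^sub>C snd (W x') = y" for x'
  proof -
    define d where "d = x' - x"
    have "d = z *\<^sub>C snd (W d)"
    proof -
      have "d = (x' - z *\<^sub>C snd (W x')) - (x - z *\<^sub>C snd (W x)) + z *\<^sub>C snd (W d)"
        by (simp add: d_def W_lin scaleC_diff_right)
      also have "(x' - z *\<^sub>C snd (W x')) - (x - z *\<^sub>C snd (W x)) = 0"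
        using that assms(2) by simp
      finally show ?thesis unfolding add_0 .
    qed
    then have "norm d = norm (z *\<^sub>C snd (W d))" by (rule arg_cong)
    also have "\<dots> = cmod z * norm (snd (W d))" by (rule norm_scaleC)
    also have "\<dots> \<le> cmod z * norm d"
      by (intro mult_left_mono order_trans[OF norm_snd_le_prod norm_W]) simp
    finally have "(1 - cmod z) * norm d \<le> 0" by (simp add: algebra_simps)
    then have "norm d \<le> 0" using assms(1) by (simp add: mult_le_0_iff)
    then show ?thesis by (simp add: d_def)
  qed
  have W2: "\<omega>2 (proj F v) = snd (W v)" for v by (simp add: W_def)
  show ?thesis
    unfolding resolv_def op_inv_def W2 by (rule the_equality, rule assms(2), rule unique)
qed

text \<open>Multiplying the recursion by z^(n+1) and summing gives y(z) - z A y(z) = b(z).\<close>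

lemma resolv_h2_eval:
  assumes z: "cmod z < 1"
    and y: "\<And>n. norm (y n) \<le> K" and b: "\<And>n. norm (b n) \<le> L"
    and y0: "y 0 = b 0" and rec: "\<And>n. y (Suc n) = snd (W (y n)) + b (Suc n)"
  shows "resolv F \<omega>2 z (h2_eval b z) = h2_eval y z"
proof (rule resolv_eqI[OF z])
  note A = cbounded_linear_compose[OF cbounded_linear_snd W_cbounded_linear]
  have Ay: "norm (snd (W (y n))) \<le> K" for n
    using order_trans[OF norm_snd_le_prod norm_W, of "y n"] y[of n] by linarith
  have "h2_eval y z = b 0 + z *\<^sub>C h2_eval (\<lambda>n. snd (W (y n)) + b (Suc n)) z"
    using h2_eval_shift[of y, OF y z] by (simp add: y0 rec)
  also have "h2_eval (\<lambda>n. snd (W (y n)) + b (Suc n)) z = snd (W (h2_eval y z)) + h2_eval (\<lambda>n. b (Suc n)) z"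
    using h2_eval_add[of "\<lambda>n. snd (W (y n))" K "\<lambda>n. b (Suc n)" L, OF Ay b z] h2_eval_linear[where a = y, OF A y z] by simp
  finally have "h2_eval y z = b 0 + (z *\<^sub>C snd (W (h2_eval y z)) + z *\<^sub>C h2_eval (\<lambda>n. b (Suc n)) z)"
    unfolding scaleC_add_right .
  then show "h2_eval y z - z *\<^sub>C snd (W (h2_eval y z)) = h2_eval b z"
    unfolding h2_eval_shift[of b, OF b z] diff_eq_eq by (rule trans) (simp only: add_ac)
qed

lemma G_cbounded_linear: "cbounded_linear (\<lambda>x. x - P x)"
proof (rule cbounded_linearI[where K = 1])
  show "norm (x - P x) \<le> 1 * norm x" for x
    using norm_proj[OF closed_csubspace_orth_compl[of F], of x] by (simp add: proj_orth_compl[OF F])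
qed (simp_all add: proj_add[OF F] proj_scaleC[OF F] scaleC_diff_right)

lemma W1_cbounded_linear: "cbounded_linear (\<lambda>x. fst (W x))"
  by (rule cbounded_linear_compose[OF cbounded_linear_fst W_cbounded_linear])

lemma zero_H2: "(\<lambda>n. 0) \<in> H2 UNIV"
  by (simp add: H2_def)

lemma h2_eval_const:
  "cmod z < 1 \<Longrightarrow> h2_eval (\<lambda>n. if n = 0 then u else 0) z = (u::'u)"
  using h2_eval_shift[of "\<lambda>n. if n = 0 then u else 0" "norm u" z] by (simp add: h2_eval_def)

text \<open>The initial value acts as an impulse: a forcing term equal to \<open>u\<close> at time 0
  and to 0 afterwards.\<close>

lemma resolv_state_initial:
  assumes "cmod z < 1"
  shows "resolv F \<omega>2 z u = h2_eval (state u (\<lambda>n. 0)) z"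
  using resolv_h2_eval[where y = "state u (\<lambda>n. 0)" and b = "\<lambda>n. if n = 0 then u else 0" and L = "norm u", OF assms norm_state_le[OF zero_H2]]
  by (simp add: h2_eval_const[OF assms] D_lin)

lemma gamma_op_Phi12: "gamma_op (Phi12 F \<omega>1 \<omega>2) u = out1 u (\<lambda>n. 0)"
proof (rule gamma_op_eqI)
  show "out1 u (\<lambda>n. 0) \<in> H2 UNIV" using out_H2(1)[OF zero_H2] by (auto simp: H2_def)
  show "h2_eval (out1 u (\<lambda>n. 0)) z = Phi12 F \<omega>1 \<omega>2 z u" if "cmod z < 1" for z
    using h2_eval_linear[where a = "state u (\<lambda>n. 0)", OF G_cbounded_linear norm_state_le[OF zero_H2] that]
    by (simp add: out1_def[abs_def] Phi12_def proj_orth_compl[OF F] resolv_state_initial[OF that])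
qed

lemma gamma_op_Phi22: "gamma_op (Phi22 F \<omega>1 \<omega>2) u = out2 u (\<lambda>n. 0)"
proof (rule gamma_op_eqI)
  show "out2 u (\<lambda>n. 0) \<in> H2 UNIV" by (rule out_H2(2)[OF zero_H2])
  show "h2_eval (out2 u (\<lambda>n. 0)) z = Phi22 F \<omega>1 \<omega>2 z u" if "cmod z < 1" for z
    using h2_eval_linear[where a = "state u (\<lambda>n. 0)", OF W1_cbounded_linear norm_state_le[OF zero_H2] that]
    by (simp add: out2_def[abs_def] Phi22_def D_lin resolv_state_initial[OF that])
      (simp add: W_def)
qed

text \<open>With initial state 0, it is the shifted sequence of states that solves the recursion
  forced by \<open>snd (D (f n))\<close>; the shift accounts for the factor
  \<open>z\<close>.\<close>

lemma resolv_state_input: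
  assumes z: "cmod z < 1" and f: "f \<in> H2 Z"
  shows "z *\<^sub>C resolv F \<omega>2 z (snd (D (h2_eval f z))) = h2_eval (state 0 f) z"
proof -
  note x = norm_state_le[OF f, of 0] and fb = H2_bounded[OF f]
  have b: "norm (snd (D (f n))) \<le> sqrt (\<Sum>n. (norm (f n))\<^sup>2)" for n
    using order_trans[OF norm_snd_le_prod norm_D, of "f n"] fb[of n] by linarith
  have "resolv F \<omega>2 z (h2_eval (\<lambda>n. snd (D (f n))) z) = h2_eval (\<lambda>n. state 0 f (Suc n)) z"
    by (rule resolv_h2_eval[OF z x b]) (simp_all add: W_lin)
  moreover have "snd (D (h2_eval f z)) = h2_eval (\<lambda>n. snd (D (f n))) z"
    by (rule h2_eval_linear[OF cbounded_linear_compose[OF cbounded_linear_snd D_props(1)] fb z])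
  ultimately show ?thesis
    using h2_eval_shift[of "state 0 f", OF x z] by simp
qed

lemma mult_op_Phi11:
  assumes f: "f \<in> H2 Z"
  shows "mult_op (Phi11 F \<omega>1 \<omega>2) f = out1 0 f"
proof (rule mult_op_eqI)
  show "out1 0 f \<in> H2 UNIV" using out_H2(1)[OF f] by (auto simp: H2_def)
  show "h2_eval (out1 0 f) z = Phi11 F \<omega>1 \<omega>2 z (h2_eval f z)" if z: "cmod z < 1" for z
    using h2_eval_linear[where a = "state 0 f", OF G_cbounded_linear norm_state_le[OF f] z]
    by (simp add: out1_def[abs_def] Phi11_def proj_orth_compl[OF F] resolv_state_input[OF z f, symmetric]
        scaleC_diff_right proj_scaleC[OF F])
qed

lemma mult_op_Phi21:
  assumes f: "f \<in> H2 Z"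
  shows "mult_op (Phi21 F \<omega>1 \<omega>2) f = out2 0 f"
proof (rule mult_op_eqI)
  show "out2 0 f \<in> H2 UNIV" by (rule out_H2(2)[OF f])
  fix z :: complex assume z: "cmod z < 1"
  note x = norm_state_le[OF f, of 0] and fb = H2_bounded[OF f]
  note D1 = cbounded_linear_compose[OF cbounded_linear_fst D_props(1)]
  have b: "norm (fst (D (f n))) \<le> sqrt (\<Sum>n. (norm (f n))\<^sup>2)" for n
    using order_trans[OF norm_fst_le_prod norm_D, of "f n"] fb[of n] by linarith
  have Wb: "norm (fst (W (state 0 f n))) \<le> sqrt ((norm (0::'u))\<^sup>2 + (\<Sum>n. (norm (f n))\<^sup>2))" for n
    using order_trans[OF norm_fst_le_prod norm_W, of "state 0 f n"] x[of n] by linarith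
  have "h2_eval (out2 0 f) z = h2_eval (\<lambda>n. fst (W (state 0 f n)) + fst (D (f n))) z"
    by (simp add: out2_def[abs_def])
  also have "\<dots> = h2_eval (\<lambda>n. fst (W (state 0 f n))) z + h2_eval (\<lambda>n. fst (D (f n))) z"
    by (rule h2_eval_add[OF Wb b z])
  also have "\<dots> = fst (W (h2_eval (state 0 f) z)) + fst (D (h2_eval f z))"
    using h2_eval_linear[where a = "state 0 f", OF W1_cbounded_linear x z] h2_eval_linear[where a = f, OF D1 fb z] by simp
  also have "\<dots> = Phi21 F \<omega>1 \<omega>2 z (h2_eval f z)"
    by (simp add: Phi21_def resolv_state_input[OF z f, symmetric] W_lin scaleC_prod_def)
      (simp add: W_def)
  finally show "h2_eval (out2 0 f) z = Phi21 F \<omega>1 \<omega>2 z (h2_eval f z)" .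
qed

text \<open>Superposition of the response to the input \<open>f\<close> and the response to the
  initial state \<open>u\<close>. From here on only sequences are handled, no longer functions on
  the disc.\<close>

lemma block_op_eq:
  assumes f: "f \<in> H2 Z"
  shows "block_op F \<omega>1 \<omega>2 (f, u) = (out1 u f, out2 u f)"
proof -
  have "state u f n = state 0 f n + state u (\<lambda>n. 0) n" for n
    using state_add[of 0 u f "\<lambda>n. 0" n] by simp
  then show ?thesis
    by (simp add: block_op_def mult_op_Phi11[OF f] mult_op_Phi21[OF f] gamma_op_Phi12 gamma_op_Phi22
        out1_def out2_def fun_eq_iff W_lin D_lin proj_add[OF F] del: state.simps)
qed

section \<open>The backward system\<close>

text \<open>The adjoint runs the colligation backwards in time; \<open>costate_approx\<close> truncates that recursion
  by starting with state \<open>0\<close> at time \<open>n + k\<close>.\<close>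

primrec costate_approx :: "(nat \<Rightarrow> 'u) \<Rightarrow> (nat \<Rightarrow> 'y) \<Rightarrow> nat \<Rightarrow> nat \<Rightarrow> 'u" where
  "costate_approx g h 0 n = 0"
| "costate_approx g h (Suc k) n = g n + adj (h n, costate_approx g h k (Suc n))"

definition costate :: "(nat \<Rightarrow> 'u) \<Rightarrow> (nat \<Rightarrow> 'y) \<Rightarrow> nat \<Rightarrow> 'u" where
  "costate g h n = lim (\<lambda>k. costate_approx g h k n)"

text \<open>The two summands are orthogonal, \<open>adj p\<close> lying in \<open>F\<close>.\<close>

lemma norm_backward_step:
  assumes "g \<in> orth_compl F"
  shows "(norm (g + adj p))\<^sup>2 = (norm g)\<^sup>2 + (norm (adj p))\<^sup>2"
  using assms adj_in[of p] cinner_commute[of g "adj p"] by (simp add: norm_add_sq orth_compl_def)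

lemma norm_costate_approx:
  assumes g: "\<And>n. g n \<in> orth_compl F"
  shows "(norm (costate_approx g h k n))\<^sup>2 \<le> (\<Sum>j<k. (norm (g (n + j)))\<^sup>2 + (norm (h (n + j)))\<^sup>2)"
proof (induction k arbitrary: n)
  case (Suc k)
  let ?p = "(h n, costate_approx g h k (Suc n))"
  have "(norm (costate_approx g h (Suc k) n))\<^sup>2 = (norm (g n))\<^sup>2 + (norm (adj ?p))\<^sup>2"
    by (simp add: norm_backward_step[OF g])
  also have "(norm (adj ?p))\<^sup>2 \<le> (norm ?p)\<^sup>2" by (intro power_mono norm_adj) simp
  also have "\<dots> = (norm (h n))\<^sup>2 + (norm (costate_approx g h k (Suc n)))\<^sup>2" by (simp only: norm_prod_sq)
  also have "\<dots> \<le> (norm (h n))\<^sup>2 + (\<Sum>j<k. (norm (g (Suc n + j)))\<^sup>2 + (norm (h (Suc n + j)))\<^sup>2)"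
    using Suc[of "Suc n"] by simp
  finally show ?case by (simp add: sum.lessThan_Suc_shift del: sum.lessThan_Suc)
qed simp

lemma norm_adj_diff: "norm (adj (h, x) - adj (h, y)) \<le> norm (x - y)"
proof -
  have "adj (h, x) - adj (h, y) = adj (0, x - y)" by (simp add: adj_lin(3)[symmetric])
  then show ?thesis using norm_adj[of "(0, x - y)"] by (simp add: norm_prod_def)
qed

text \<open>Both truncations run the same \<open>k\<close> contractive steps back from time
  \<open>n + k\<close>; there the longer one holds \<open>costate_approx g h m (n + k)\<close> and
  the shorter one holds 0.\<close>

lemma norm_costate_approx_diff:
  "norm (costate_approx g h (k + m) n - costate_approx g h k n) \<le> norm (costate_approx g h m (n + k))"
proof (induction k arbitrary: n)
  case (Suc k)
  show ?case
    using norm_adj_diff[of "h n" "costate_approx g h (k + m) (Suc n)" "costate_approx g h k (Suc n)"]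
      Suc[of "Suc n"] by simp
qed simp

section \<open>The costate of a square-summable output, and the adjoint\<close>

context
  fixes g :: "nat \<Rightarrow> 'u" and h :: "nat \<Rightarrow> 'y"
  assumes g: "g \<in> H2 (orth_compl F)" and h: "h \<in> H2 UNIV"
begin

definition energy :: "nat \<Rightarrow> real" where "energy n = (norm (g n))\<^sup>2 + (norm (h n))\<^sup>2"

definition tail :: "nat \<Rightarrow> real" where "tail n = (\<Sum>j. energy (n + j))"

lemma energy_nonneg: "0 \<le> energy n"
  by (simp add: energy_def)

lemma summable_energy: "summable energy"
  using g h unfolding energy_def[abs_def] H2_def by (auto intro: summable_add)

lemma tail_eq: "tail n = suminf energy - (\<Sum>j<n. energy j)"
  unfolding tail_def using suminf_minus_initial_segment[OF summable_energy, of n] by (simp add: add.commute)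

lemma tail_lim: "tail \<longlonglongrightarrow> 0"
  using tendsto_diff[OF tendsto_const summable_LIMSEQ[OF summable_energy], of "suminf energy"]
  by (simp add: tail_eq[abs_def])

lemma norm_costate_approx_tail: "(norm (costate_approx g h k n))\<^sup>2 \<le> tail n"
proof -
  have "(norm (costate_approx g h k n))\<^sup>2 \<le> (\<Sum>j<k. energy (n + j))"
    unfolding energy_def using g by (intro norm_costate_approx) (auto simp: H2_def)
  also have "\<dots> \<le> tail n"
    unfolding tail_def using summable_ignore_initial_segment[OF summable_energy, of n]
    by (intro sum_le_suminf) (auto simp: energy_nonneg add.commute)
  finally show ?thesis .
qed

text \<open>Two truncations at levels \<open>k < l\<close> differ by at most the square root of
  \<open>tail (n + k)\<close>, which tends to 0.\<close>

lemma costate_approx_lim: "(\<lambda>k. costate_approx g h k n) \<longlonglongrightarrow> costate g h n"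
proof -
  have "Cauchy (\<lambda>k. costate_approx g h k n)"
  proof (rule CauchyI')
    fix e :: real assume e: "0 < e"
    then have "\<forall>\<^sub>F k in sequentially. tail k < e\<^sup>2"
      using order_tendstoD(2)[OF tail_lim] by simp
    then obtain M where M: "\<And>k. k \<ge> M \<Longrightarrow> tail k < e\<^sup>2" by (auto simp: eventually_sequentially)
    show "\<exists>M. \<forall>k\<ge>M. \<forall>l>k. dist (costate_approx g h k n) (costate_approx g h l n) < e"
    proof (intro exI allI impI)
      fix k l assume kl: "M \<le> k" "k < l"
      have "norm (costate_approx g h l n - costate_approx g h k n) \<le> norm (costate_approx g h (l - k) (n + k))"
        using norm_costate_approx_diff[of g h k "l - k" n] kl by simp
      also have "\<dots> < e"
      proof (rule power2_less_imp_less)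
        show "(norm (costate_approx g h (l - k) (n + k)))\<^sup>2 < e\<^sup>2"
          by (rule le_less_trans[OF norm_costate_approx_tail M]) (use kl in simp)
      qed (use e in simp)
      finally show "dist (costate_approx g h k n) (costate_approx g h l n) < e"
        by (simp add: dist_norm norm_minus_commute)
    qed
  qed
  then show ?thesis
    unfolding costate_def by (simp add: Cauchy_convergent_iff convergent_LIMSEQ_iff)
qed

lemma norm_costate: "(norm (costate g h n))\<^sup>2 \<le> tail n"
  by (rule LIMSEQ_le_const2[OF tendsto_power[OF tendsto_norm[OF costate_approx_lim]]])
    (use norm_costate_approx_tail in blast)

lemma costate_lim: "costate g h \<longlonglongrightarrow> 0"
proof -
  have "(\<lambda>n. (norm (costate g h n))\<^sup>2) \<longlonglongrightarrow> 0"
    by (rule Lim_null_comparison[OF always_eventually tail_lim]) (simp add: norm_costate)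
  then have "(\<lambda>n. sqrt ((norm (costate g h n))\<^sup>2)) \<longlonglongrightarrow> sqrt 0" by (rule tendsto_real_sqrt)
  then show ?thesis by (simp add: tendsto_norm_zero_iff)
qed

lemma costate_rec: "costate g h n = g n + adj (h n, costate g h (Suc n))"
proof (rule LIMSEQ_unique)
  show "(\<lambda>k. costate_approx g h (Suc k) n) \<longlonglongrightarrow> costate g h n"
    by (rule LIMSEQ_Suc[OF costate_approx_lim])
  have "(\<lambda>k. adj (h n, costate_approx g h k (Suc n))) \<longlonglongrightarrow> adj (h n, costate g h (Suc n))"
    by (intro bounded_linear.tendsto[OF cbounded_linear_bounded_linear[OF adj_cbounded_linear]]
        tendsto_Pair tendsto_const costate_approx_lim)
  then show "(\<lambda>k. costate_approx g h (Suc k) n) \<longlonglongrightarrow> g n + adj (h n, costate g h (Suc n))"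
    by (simp add: tendsto_add)
qed

text \<open>The distance between two solutions cannot decrease as \<open>n\<close> grows, because
  \<open>adj\<close> is contractive; it also tends to 0, so it is 0 throughout.\<close>

lemma costate_unique:
  assumes rec: "\<And>n. x n = g n + adj (h n, x (Suc n))" and lim: "x \<longlonglongrightarrow> 0"
  shows "x n = costate g h n"
proof -
  define e where "e n = norm (x n - costate g h n)" for n
  have "e n \<le> e (Suc n)" for n
    using norm_adj_diff[of "h n" "x (Suc n)" "costate g h (Suc n)"]
    by (simp add: e_def rec[of n] costate_rec[of n])
  then have "incseq e" by (rule incseq_SucI)
  moreover have "e \<longlonglongrightarrow> 0"
    unfolding e_def[abs_def] using tendsto_norm[OF tendsto_diff[OF lim costate_lim]] by simp
  ultimately have "e n \<le> 0" by (rule incseq_le)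
  then show ?thesis by (simp add: e_def)
qed

text \<open>The backward system loses no energy, since the column (\<open>adj\<close>,
  \<open>D\<close>) is isometric.\<close>

lemma costate_energy:
  "(norm (costate g h n))\<^sup>2 + (norm (D (h n, costate g h (Suc n))))\<^sup>2 = energy n + (norm (costate g h (Suc n)))\<^sup>2"
proof -
  have "g n \<in> orth_compl F" using g by (simp add: H2_def)
  from norm_backward_step[OF this, of "(h n, costate g h (Suc n))"]
  show ?thesis
    using norm_adj_D[of "(h n, costate g h (Suc n))"]
    by (simp add: costate_rec[symmetric] norm_prod_sq energy_def)
qed

text \<open>First component of the adjoint at \<open>(g, h)\<close>; the second one is
  \<open>costate g h 0\<close>.\<close>

definition input :: "nat \<Rightarrow> 'y \<times> 'u" where
  "input n = D (h n, costate g h (Suc n))"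

lemma input_H2: "input \<in> H2 (closure (range D))"
proof -
  have bal: "(norm (costate g h 0))\<^sup>2 + (\<Sum>n<N. (norm (input n))\<^sup>2) = (\<Sum>n<N. energy n) + (norm (costate g h N))\<^sup>2" for N
  proof (induction N)
    case (Suc N)
    then show ?case using costate_energy[of N] by (simp add: input_def)
  qed simp
  have "(\<Sum>n<N. (norm (input n))\<^sup>2) \<le> suminf energy" for N
  proof -
    show ?thesis
      \<comment> \<open>The costate energy at time \<open>N\<close> is at most the tail, which
        completes the partial sum to \<open>suminf energy\<close>.\<close>
      using bal[of N] norm_costate[of N] tail_eq[of N] zero_le_power2[of "norm (costate g h 0)"] by linarith
  qed
  then have "summable (\<lambda>n. (norm (input n))\<^sup>2)"
    by (intro bounded_imp_summable[where B = "suminf energy"])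
      (auto simp: lessThan_Suc_atMost[symmetric] simp del: sum.lessThan_Suc)
  then show ?thesis
    using closure_subset[of "range D"] by (auto simp: H2_def input_def)
qed

text \<open>With p the pair of \<open>h n\<close> and the next costate, the projection of the
  current costate to \<open>F\<close> is \<open>adj p\<close>. Hence the forward step yields
  \<open>W (adj p) + D (D p) = p\<close>, whose second entry is the next costate.\<close>

lemma state_input: "state (costate g h 0) input n = costate g h n"
proof (induction n)
  case (Suc n)
  let ?p = "(h n, costate g h (Suc n))"
  have "P (costate g h n) = adj ?p"
    using g by (simp add: costate_rec[of n] proj_add[OF F] P_orth_compl H2_def)
  then have "W (costate g h n) = W (adj ?p)" by (simp add: W_def)
  then show ?case using Suc by (simp add: input_def D_props(3))
qed simp

lemma out_input: "out1 (costate g h 0) input = g" "out2 (costate g h 0) input = h"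
proof -
  have *: "P (costate g h n) = adj (h n, costate g h (Suc n))" for n
    using g by (simp add: costate_rec[of n] proj_add[OF F] P_orth_compl H2_def)
  show "out1 (costate g h 0) input = g"
    unfolding out1_def state_input * by (rule ext, subst costate_rec) simp
  have "W (costate g h n) = W (adj (h n, costate g h (Suc n)))" for n
    using * by (simp add: W_def)
  then show "out2 (costate g h 0) input = h"
    by (simp add: out2_def state_input input_def D_props(3) fun_eq_iff)
qed

text \<open>Duality over one time step: \<open>W\<close> and \<open>D\<close> are moved across the
  pairing, and against \<open>g n\<close> the output \<open>out1\<close> may be replaced by the full
  state.\<close>

lemma adjoint_step:
  "cinner (out1 u f n) (g n) + cinner (out2 u f n) (h n) + cinner (state u f (Suc n)) (costate g h (Suc n))
    = cinner (state u f n) (costate g h n) + cinner (f n) (input n)"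
proof -
  let ?p = "(h n, costate g h (Suc n))"
  have "cinner (out2 u f n) (h n) + cinner (state u f (Suc n)) (costate g h (Suc n))
      = cinner (W (state u f n) + D (f n)) ?p"
    by (simp only: cinner_Pair[symmetric] out2_state)
  also have "\<dots> = cinner (state u f n) (adj ?p) + cinner (f n) (input n)"
    by (simp add: cinner_add_left cinner_W D_selfadj input_def)
  finally have 1: "cinner (out2 u f n) (h n) + cinner (state u f (Suc n)) (costate g h (Suc n))
      = cinner (state u f n) (adj ?p) + cinner (f n) (input n)" .
  have "cinner (P (state u f n)) (g n) = 0"
    using g P_in[of "state u f n"] cinner_commute[of "P (state u f n)" "g n"]
    by (simp add: H2_def orth_compl_def)
  then have 2: "cinner (out1 u f n) (g n) = cinner (state u f n) (g n)"
    by (simp add: out1_def cinner_diff_left)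
  show ?thesis using 1 2 by (simp add: costate_rec[of n] cinner_add_right del: state.simps)
qed

text \<open>Summing \<open>adjoint_step\<close> telescopes. The boundary term at \<open>N\<close>
  vanishes in the limit because states are bounded and costates tend to 0.\<close>

lemma adjoint_identity:
  assumes f: "f \<in> H2 Z"
  shows "h2_inner (out1 u f) g + h2_inner (out2 u f) h = h2_inner f input + cinner u (costate g h 0)"
proof -
  let ?a = "\<lambda>n. cinner (out1 u f n) (g n)" and ?b = "\<lambda>n. cinner (out2 u f n) (h n)"
    and ?c = "\<lambda>n. cinner (f n) (input n)"
  have sum: "(\<Sum>n<N. ?a n) + (\<Sum>n<N. ?b n) + cinner (state u f N) (costate g h N)
      = (\<Sum>n<N. ?c n) + cinner u (costate g h 0)" for N
  proof (induction N)
    case (Suc N)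
    show ?case unfolding sum.lessThan_Suc using Suc adjoint_step[of u f N] by algebra
  qed simp
  have sm: "summable (\<lambda>n. (norm (a n))\<^sup>2)" if "a \<in> H2 X" for a :: "nat \<Rightarrow> 'v::chilbert_space" and X
    using that by (simp add: H2_def)
  have lims: "(\<lambda>N. \<Sum>n<N. ?a n) \<longlonglongrightarrow> h2_inner (out1 u f) g"
    "(\<lambda>N. \<Sum>n<N. ?b n) \<longlonglongrightarrow> h2_inner (out2 u f) h"
    "(\<lambda>N. \<Sum>n<N. ?c n) \<longlonglongrightarrow> h2_inner f input"
    unfolding h2_inner_def
    by (intro summable_LIMSEQ summable_h2_inner sm[OF out_H2(1)[OF f]] sm[OF g] sm[OF out_H2(2)[OF f]] sm[OF h]
        sm[OF f] sm[OF input_H2])+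
  define K where "K = sqrt ((norm u)\<^sup>2 + (\<Sum>n. (norm (f n))\<^sup>2))"
  have "(\<lambda>N. cinner (state u f N) (costate g h N)) \<longlonglongrightarrow> 0"
  proof (rule Lim_null_comparison[OF always_eventually], rule allI)
    fix N
    have "norm (cinner (state u f N) (costate g h N)) \<le> norm (state u f N) * norm (costate g h N)"
      by (rule cinner_cauchy_schwarz)
    also have "\<dots> \<le> K * norm (costate g h N)"
      unfolding K_def by (intro mult_right_mono norm_state_le[OF f]) simp
    finally show "norm (cinner (state u f N) (costate g h N)) \<le> K * norm (costate g h N)" .
    show "(\<lambda>N. K * norm (costate g h N)) \<longlonglongrightarrow> 0"
      by (intro tendsto_mult_right_zero tendsto_norm_zero costate_lim)
  qed
  from tendsto_add[OF tendsto_add[OF lims(1,2)] this]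
  have "(\<lambda>N. (\<Sum>n<N. ?c n) + cinner u (costate g h 0)) \<longlonglongrightarrow> h2_inner (out1 u f) g + h2_inner (out2 u f) h"
    by (simp add: sum)
  then show ?thesis
    using tendsto_add[OF lims(3) tendsto_const] LIMSEQ_unique by blast
qed

end

section \<open>Decay of the state under pointwise stability\<close>

lemma state_shift: "state u f (M + k) = state (state u f M) (\<lambda>n. f (M + n)) k"
  by (induction k) simp_all

lemma state_zero_input: "state u (\<lambda>n. 0) k = ((\<omega>2 \<circ> P) ^^ k) u"
  by (induction k) (simp_all add: D_lin W_def)

text \<open>After restarting at a late time \<open>M\<close>, the free response decays by stability,
  while the forced response is bounded, uniformly in time, by the input energy left after
  \<open>M\<close>.\<close>

lemma state_lim:
  assumes stable: "\<And>u. (\<lambda>n. ((\<omega>2 \<circ> P) ^^ n) u) \<longlonglongrightarrow> 0" and f: "f \<in> H2 Z"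
  shows "state u f \<longlonglongrightarrow> 0"
proof (rule LIMSEQ_I)
  fix e :: real assume e: "0 < e"
  have s: "summable (\<lambda>n. (norm (f n))\<^sup>2)" using f by (simp add: H2_def)
  obtain M where M: "norm (\<Sum>n. (norm (f (n + M)))\<^sup>2) < (e / 2)\<^sup>2"
    using suminf_exist_split[OF _ s, of "(e / 2)\<^sup>2"] e by auto
  have fM: "(\<lambda>n. f (M + n)) \<in> H2 UNIV"
    using summable_ignore_initial_segment[OF s, of M] by (simp add: H2_def add.commute)
  obtain N where N: "\<And>k. k \<ge> N \<Longrightarrow> norm (((\<omega>2 \<circ> P) ^^ k) (state u f M)) < e / 2"
    using LIMSEQ_D[OF stable[of "state u f M"], of "e / 2"] e by auto
  have small: "norm (state u f (M + k)) < e" if "k \<ge> N" for k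
  proof -
    have "state u f (M + k) = ((\<omega>2 \<circ> P) ^^ k) (state u f M) + state 0 (\<lambda>n. f (M + n)) k"
      using state_add[of "state u f M" 0 "\<lambda>n. 0" "\<lambda>n. f (M + n)" k]
      by (simp add: state_shift state_zero_input)
    moreover have "norm (state 0 (\<lambda>n. f (M + n)) k) \<le> e / 2"
    proof (rule order_trans[OF norm_state_le[OF fM]])
      have "(\<Sum>n. (norm (f (M + n)))\<^sup>2) \<le> (e / 2)\<^sup>2" using M by (simp add: add.commute)
      then show "sqrt ((norm (0::'u))\<^sup>2 + (\<Sum>n. (norm (f (M + n)))\<^sup>2)) \<le> e / 2"
        by (intro real_le_lsqrt) (use e in simp_all)
    qed
    ultimately show ?thesis
      using N[OF that] norm_triangle_ineq[of "((\<omega>2 \<circ> P) ^^ k) (state u f M)" "state 0 (\<lambda>n. f (M + n)) k"]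
      by simp
  qed
  show "\<exists>no. \<forall>n\<ge>no. norm (state u f n - 0) < e"
  proof (intro exI allI impI)
    fix n assume "M + N \<le> n"
    then show "norm (state u f n - 0) < e" using small[of "n - M"] by simp
  qed
qed

section \<open>The isometric case\<close>

context
  assumes iso: "omega_isometry F \<omega>1 \<omega>2"
begin

lemma norm_W_iso: "norm (W x) = norm (P x)"
  using iso P_in[of x] by (simp add: omega_isometry_def W_def norm_prod_def)

text \<open>In the expanded square of the difference the cross term equals
  \<open>(norm (W x))\<^sup>2\<close>, and neither of the two squares exceeds this value.\<close>

lemma adj_W: "adj (W x) = P x"
proof -
  note norm_W_iso[of x]
  moreover have "(norm (adj (W x) - P x))\<^sup>2 = (norm (adj (W x)))\<^sup>2 + (norm (P x))\<^sup>2 - 2 * (norm (W x))\<^sup>2"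
  proof -
    have "cinner (adj (W x)) (P x) = cinner (W x) (W x)"
      by (simp add: cinner_adj W_def proj_ident[OF F P_in])
    then show ?thesis by (simp add: norm_diff_sq cinner_self del: of_real_power)
  qed
  moreover have "(norm (adj (W x)))\<^sup>2 \<le> (norm (W x))\<^sup>2" by (intro power_mono norm_adj) simp
  ultimately have "(norm (adj (W x) - P x))\<^sup>2 \<le> 0" by simp
  then show ?thesis by simp
qed

text \<open>\<open>adj\<close> already preserves the norm of \<open>W x\<close>, so nothing remains
  for \<open>D\<close> in \<open>norm_adj_D\<close>.\<close>

lemma D_W: "D (W x) = 0"
  using norm_adj_D[of "W x"] by (simp add: adj_W norm_W_iso)

lemma adj_D: "adj (D p) = 0"
proof (rule cinner_eqI)
  show "cinner z (adj (D p)) = cinner z 0" for z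
    by (simp add: cinner_W[symmetric] D_selfadj[symmetric] D_W)
qed

text \<open>\<open>adj\<close> vanishes on the range of \<open>D\<close>, by continuity also on its
  closure, and there \<open>D (D p) = p - W (adj p)\<close> reduces to \<open>p\<close>.\<close>

lemma D_D_closure:
  assumes "p \<in> closure (range D)"
  shows "D (D p) = p" "adj p = 0"
proof -
  have cl: "closed {p. adj p = 0}"
    using continuous_closed_vimage[of "{0}" adj] linear_continuous_at[OF cbounded_linear_bounded_linear[OF adj_cbounded_linear]]
    by (auto simp: vimage_def)
  have "closure (range D) \<subseteq> {p. adj p = 0}" by (rule closure_minimal[OF _ cl]) (auto simp: adj_D)
  then show "adj p = 0" using assms by blast
  then show "D (D p) = p" by (simp add: D_props(3) W_lin)
qed

text \<open>Applying \<open>adj\<close> and \<open>D\<close> to \<open>W x + D f\<close> separates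
  the summands: \<open>adj\<close> returns the projection of \<open>x\<close> to \<open>F\<close>,
  and \<open>D\<close> returns \<open>f\<close>.\<close>

lemma backward_rec:
  assumes f: "f n \<in> closure (range D)"
  shows "state u f n = out1 u f n + adj (out2 u f n, state u f (Suc n))"
    and "f n = D (out2 u f n, state u f (Suc n))"
proof -
  have "adj (D (f n)) = 0" by (rule adj_D)
  then show "state u f n = out1 u f n + adj (out2 u f n, state u f (Suc n))"
    unfolding out2_state by (simp add: out1_def adj_lin adj_W)
  show "f n = D (out2 u f n, state u f (Suc n))"
    unfolding out2_state by (simp add: D_lin D_W D_D_closure(1)[OF f])
qed

end

end

section \<open>Co-isometry and unitarity of the block operator\<close>

theorem theorem1p2:
  fixes F :: "'u::chilbert_space set"
    and \<omega>1 :: "'u \<Rightarrow> 'y::chilbert_space"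
    and \<omega>2 :: "'u \<Rightarrow> 'u"
  assumes F: "closed_csubspace F"
    and contr: "omega_contraction F \<omega>1 \<omega>2"
  defines "Dom \<equiv> H2 (closure (range (defect_adj F \<omega>1 \<omega>2))) \<times> (UNIV :: 'u set)"
    and "Cod \<equiv> H2 (orth_compl F) \<times> H2 (UNIV :: 'y set)"
    and "ipDom \<equiv> \<lambda>(f, u) (f', u'). h2_inner f f' + cinner u u'"
    and "ipCod \<equiv> \<lambda>(g, h) (g', h'). h2_inner g g' + h2_inner h h'"
  shows "coisometry_on Dom ipDom Cod ipCod (block_op F \<omega>1 \<omega>2)
    \<and> ((omega_isometry F \<omega>1 \<omega>2
          \<and> (\<forall>u. (\<lambda>n. ((\<omega>2 \<circ> proj F) ^^ n) u) \<longlonglongrightarrow> 0))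
        \<longrightarrow> unitary_on Dom ipDom Cod ipCod (block_op F \<omega>1 \<omega>2))"
proof -
  interpret omega_setting F \<omega>1 \<omega>2 by standard (rule F, rule contr)
  \<comment> \<open>The backward system: an output pair is sent to the input and initial state that
    generate it.\<close>
  define S where "S = (\<lambda>(g, h). (input g h, costate g h 0))"
  let ?K = "block_op F \<omega>1 \<omega>2"
  have K: "?K (f, u) = (out1 u f, out2 u f)" if "f \<in> H2 (closure (range D))" for f u
    by (rule block_op_eq[OF that])
  have "?K x \<in> Cod" if "x \<in> Dom" for x
    using that out_H2 by (auto simp: Dom_def Cod_def K)
  moreover have "S y \<in> Dom" if "y \<in> Cod" for y
    using that input_H2 by (auto simp: Dom_def Cod_def S_def)
  moreover have "ipCod (?K x) y = ipDom x (S y)" if "x \<in> Dom" "y \<in> Cod" for x y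
    using that adjoint_identity by (auto simp: Dom_def Cod_def S_def ipDom_def ipCod_def K)
  ultimately have adj: "is_adjoint_on Dom ipDom Cod ipCod ?K S"
    by (auto simp: is_adjoint_on_def)
  have KS: "?K (S y) = y" if "y \<in> Cod" for y
    using that by (auto simp: Cod_def S_def K[OF input_H2] out_input)
  have "S (?K x) = x" if "x \<in> Dom" and iso: "omega_isometry F \<omega>1 \<omega>2"
    and stable: "\<forall>u. (\<lambda>n. ((\<omega>2 \<circ> proj F) ^^ n) u) \<longlonglongrightarrow> 0" for x
  proof -
    obtain f u where x: "x = (f, u)" by (cases x)
    with that(1) have f: "f \<in> H2 (closure (range D))" by (simp add: Dom_def)
    have fn: "f n \<in> closure (range D)" for n using f by (simp add: H2_def)
    note out = out_H2[OF f, of u]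
    have "state u f \<longlonglongrightarrow> 0" by (rule state_lim[OF _ f]) (use stable in blast)
    \<comment> \<open>The forward states solve the backward recursion for their own outputs and tend
      to 0, so uniqueness makes them the costates; hence \<open>S\<close> recovers both
      \<open>f\<close> and \<open>u\<close>.\<close>
    then have cs: "state u f n = costate (out1 u f) (out2 u f) n" for n
      by (rule costate_unique[OF out backward_rec(1)[where f = f, OF iso fn]])
    have "input (out1 u f) (out2 u f) n = f n" for n
      using backward_rec(2)[where f = f and n = n and u = u, OF iso fn] by (simp add: input_def[OF out] cs[symmetric] del: state.simps)
    moreover have "costate (out1 u f) (out2 u f) 0 = u" using cs[of 0] by simp
    ultimately show ?thesis by (simp add: x K[OF f] S_def fun_eq_iff)
  qed
  then show ?thesis
    using adj KS unfolding coisometry_on_def unitary_on_def by blast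
qed

end
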